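(* For every finite graph $G$ there is a sequence $(\mathcal T_k,\mathcal V_k)_{k\in\mathbb N}$ of tree-decompositions of $G$ such that, for all $k\in\mathbb N$ (including $k=0$), (i) $(\mathcal T_k,\mathcal V_k)$ has adhesion at most $k$ and distinguishes all robust $k$-blocks (that is, every two distinct robust $k$-blocks of $G$); (ii) $(\mathcal T_k,\mathcal V_k)\preccurlyeq(\mathcal T_{k+1},\mathcal V_{k+1})$; (iii) $(\mathcal T_k,\mathcal V_k)$ is $\mathrm{Aut}(G)$-invariant.
   Context: Separations. A separation of $G=(V,E)$ is an ordered pair $(A,B)$ with $A,B\subseteq V$ and $G[A]\cup G[B]=G$; its order is $|A\cap B|$, and a $k$-separation is a separation of order $k$. Write $(A,B)\le(C,D)$ if $A\subseteq C$ and $B\supseteq D$. Two separations $(A,B),(C,D)$ are nested if $(A,B)$ is $\le$-comparable with $(C,D)$ or with $(D,C)$; otherwise they cross. For two separations $(A,B),(C,D)$, the sets $A\cap C$, $A\cap D$, $B\cap C$, $B\cap D$ are the corners. The boundary $\partial K$ of a corner consists of its vertices lying in $A\cap B$ or in $C\cap D$; e.g. $\partial(A\cap D)=(A\cap D)\cap(B\cup C)$ and $\partial(B\cap D)=(B\cap D)\cap(A\cup C)$. Blocks. A set $X\subseteq V$ is $k$-inseparable if $|X|>k$ and no set $S$ of at most $k$ vertices separates two vertices of $X\setminus S$ in $G$. A $k$-block is a maximal $k$-inseparable set. A $k$-inseparable set $U$ is $K$-robust (as a $k$-inseparable set) if for every $k$-separation $(C,D)$ with $U\subseteq D$ and every separation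 $(A,B)$ of order at most $K$ that crosses $(C,D)$ and satisfies $|\partial(A\cap D)|<k$ and $|\partial(B\cap D)|<k$, we have $U\subseteq A$ or $U\subseteq B$. A $k$-block is a robust $k$-block if it is $K$-robust, as a $k$-inseparable set, for every integer $K$. Tree-decompositions. A tree-decomposition of $G$ is a pair $(\mathcal T,\mathcal V)$ of a tree $\mathcal T$ and a family $\mathcal V=(V_t)_{t\in\mathcal T}$ of subsets of $V(G)$ (parts) covering $V(G)$, such that every edge of $G$ has both ends in some $V_t$, and $V_{t_1}\cap V_{t_3}\subseteq V_{t_2}$ whenever $t_2$ lies on the $t_1$–$t_3$ path in $\mathcal T$. Its adhesion is the maximum size of a set $V_t\cap V_{t'}$ with $tt'\in E(\mathcal T)$ ($0$ if there is no edge). A tree-decomposition of adhesion at most $k$ distinguishes two $k$-blocks if they are contained in different parts. It is $\mathrm{Aut}(G)$-invariant if the automorphisms of $G$ act on the set of parts in a way that induces an action on $\mathcal T$: there is an action $t\mapsto t^\alpha$ of $\mathrm{Aut}(G)$ on $\mathcal T$ by tree automorphisms with $V_{t^\alpha}=\alpha(V_t)$ for all $t$ and $\alpha$. For tree-decompositions write $(\mathcal T_m,\mathcal V_m)\preccurlyeq(\mathcal T_n,\mathcal V_n)$ if $\mathcal T_m$ is a minor of $\mathcal T_n$ and every part $V_t\in\mathcal V_m$ of the first is the union of those parts $V_{t'}$ of the second whose nodes $t'$ were contracted to the node $t$ of $\mathcal T_m$. *)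

theory Defs
  imports
    "Graph_Theory.Pair_Digraph"
    "Graph_Theory.Digraph_Component"
    "HOL-Combinatorics.Permutations"
begin

text \<open>
  A finite simple undirected graph is a value \<open>G\<close> with \<open>pair_graph G\<close>: an undirected edge between
  \<open>u\<close> and \<open>v\<close> is represented by the two arcs \<open>(u, v)\<close> and \<open>(v, u)\<close>.
\<close>

type_synonym 'a sep = "'a set \<times> 'a set"

fun separation :: "'a pair_pre_digraph \<Rightarrow> 'a sep \<Rightarrow> bool" where
  "separation G (A, B) \<longleftrightarrow> A \<subseteq> pverts G \<and> B \<subseteq> pverts G \<and>
     Digraph_Component.union (with_proj G \<restriction> A) (with_proj G \<restriction> B) = with_proj G"

fun sep_order :: "'a sep \<Rightarrow> nat" where
  "sep_order (A, B) = card (A \<inter> B)"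

fun sep_le :: "'a sep \<Rightarrow> 'a sep \<Rightarrow> bool" where
  "sep_le (A, B) (C, D) \<longleftrightarrow> A \<subseteq> C \<and> D \<subseteq> B"

definition sep_comparable :: "'a sep \<Rightarrow> 'a sep \<Rightarrow> bool" where
  "sep_comparable s t \<longleftrightarrow> sep_le s t \<or> sep_le t s"

fun nested :: "'a sep \<Rightarrow> 'a sep \<Rightarrow> bool" where
  "nested s (C, D) \<longleftrightarrow> sep_comparable s (C, D) \<or> sep_comparable s (D, C)"

abbreviation crosses :: "'a sep \<Rightarrow> 'a sep \<Rightarrow> bool" where
  "crosses s t \<equiv> \<not> nested s t"

text \<open>The last argument is the corner whose boundary is taken.\<close>

fun boundary :: "'a sep \<Rightarrow> 'a sep \<Rightarrow> 'a set \<Rightarrow> 'a set" where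
  "boundary (A, B) (C, D) K = K \<inter> (A \<inter> B \<union> C \<inter> D)"

definition separates :: "'a pair_pre_digraph \<Rightarrow> 'a set \<Rightarrow> 'a \<Rightarrow> 'a \<Rightarrow> bool" where
  "separates G S u v \<longleftrightarrow> u \<in> pverts G - S \<and> v \<in> pverts G - S \<and>
     \<not> reachable (with_proj G \<restriction> (pverts G - S)) u v"

definition inseparable :: "'a pair_pre_digraph \<Rightarrow> nat \<Rightarrow> 'a set \<Rightarrow> bool" where
  "inseparable G k X \<longleftrightarrow> X \<subseteq> pverts G \<and> k < card X \<and>
     \<not> (\<exists>S u v. S \<subseteq> pverts G \<and> card S \<le> k \<and> u \<in> X - S \<and> v \<in> X - S \<and> u \<noteq> v \<and>
          separates G S u v)"

definition block :: "'a pair_pre_digraph \<Rightarrow> nat \<Rightarrow> 'a set \<Rightarrow> bool" where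
  "block G k X \<longleftrightarrow> inseparable G k X \<and> (\<forall>Y. inseparable G k Y \<and> X \<subseteq> Y \<longrightarrow> Y = X)"

definition robust :: "'a pair_pre_digraph \<Rightarrow> nat \<Rightarrow> int \<Rightarrow> 'a set \<Rightarrow> bool" where
  "robust G k K U \<longleftrightarrow> inseparable G k U \<and>
     (\<forall>A B C D.
        separation G (C, D) \<and> sep_order (C, D) = k \<and> U \<subseteq> D \<and>
        separation G (A, B) \<and> int (sep_order (A, B)) \<le> K \<and> crosses (A, B) (C, D) \<and>
        card (boundary (A, B) (C, D) (A \<inter> D)) < k \<and>
        card (boundary (A, B) (C, D) (B \<inter> D)) < k
        \<longrightarrow> U \<subseteq> A \<or> U \<subseteq> B)"

definition robust_block :: "'a pair_pre_digraph \<Rightarrow> nat \<Rightarrow> 'a set \<Rightarrow> bool" where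
  "robust_block G k X \<longleftrightarrow> block G k X \<and> (\<forall>K. robust G k K X)"

text \<open>
  The constants \<open>forest\<close> and \<open>tree\<close> of the digraph library are not suitable here: they count
  traversing an edge back and forth as a cycle. Only cycles of length at least 3 are cycles of the
  undirected graph. Trees are finite and, by \<open>connected\<close>, nonempty.
\<close>

definition undirected_tree :: "'t pair_pre_digraph \<Rightarrow> bool" where
  "undirected_tree T \<longleftrightarrow> pair_graph T \<and> Digraph_Component.connected (with_proj T) \<and>
     \<not> (\<exists>p. pre_digraph.cycle (with_proj T) p \<and> 3 \<le> length p)"

definition on_path :: "'t pair_pre_digraph \<Rightarrow> 't \<Rightarrow> 't \<Rightarrow> 't \<Rightarrow> bool" where
  "on_path T t1 t2 t3 \<longleftrightarrow>
     (\<exists>p. pre_digraph.apath (with_proj T) t1 p t3 \<and> t2 \<in> set (pawalk_verts t1 p))"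

definition tree_decomposition ::
  "'a pair_pre_digraph \<Rightarrow> 't pair_pre_digraph \<Rightarrow> ('t \<Rightarrow> 'a set) \<Rightarrow> bool" where
  "tree_decomposition G T V \<longleftrightarrow> undirected_tree T \<and>
     (\<Union>t\<in>pverts T. V t) = pverts G \<and>
     (\<forall>(u, v)\<in>parcs G. \<exists>t\<in>pverts T. u \<in> V t \<and> v \<in> V t) \<and>
     (\<forall>t1\<in>pverts T. \<forall>t2\<in>pverts T. \<forall>t3\<in>pverts T. on_path T t1 t2 t3 \<longrightarrow> V t1 \<inter> V t3 \<subseteq> V t2)"

definition adhesion :: "'t pair_pre_digraph \<Rightarrow> ('t \<Rightarrow> 'a set) \<Rightarrow> nat" where
  "adhesion T V =
     (if parcs T = {} then 0 else Max ((\<lambda>(t, t'). card (V t \<inter> V t')) ` parcs T))"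

definition distinguishes :: "'t pair_pre_digraph \<Rightarrow> ('t \<Rightarrow> 'a set) \<Rightarrow> 'a set \<Rightarrow> 'a set \<Rightarrow> bool" where
  "distinguishes T V X Y \<longleftrightarrow>
     (\<exists>t\<in>pverts T. \<exists>t'\<in>pverts T. V t \<noteq> V t' \<and> X \<subseteq> V t \<and> Y \<subseteq> V t')"

text \<open>
  Automorphisms are normalised to be the identity outside the vertex set, so that each automorphism
  is represented by exactly one function and \<open>Aut G\<close> is a group under composition.
\<close>

definition Aut :: "'a pair_pre_digraph \<Rightarrow> ('a \<Rightarrow> 'a) set" where
  "Aut G = {\<alpha>. \<alpha> permutes pverts G \<and>
     (\<forall>u\<in>pverts G. \<forall>v\<in>pverts G. (\<alpha> u, \<alpha> v) \<in> parcs G \<longleftrightarrow> (u, v) \<in> parcs G)}"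

text \<open>
  \<open>\<phi> \<alpha> t\<close> is the image of the node \<open>t\<close> under \<open>\<alpha>\<close>; acting with \<open>\<beta> \<circ> \<alpha>\<close> is acting with \<open>\<alpha>\<close> first and
  then with \<open>\<beta>\<close>.
\<close>

definition Aut_invariant ::
  "'a pair_pre_digraph \<Rightarrow> 't pair_pre_digraph \<Rightarrow> ('t \<Rightarrow> 'a set) \<Rightarrow> bool" where
  "Aut_invariant G T V \<longleftrightarrow> (\<exists>\<phi>.
     (\<forall>\<alpha>\<in>Aut G. \<phi> \<alpha> \<in> Aut T) \<and>
     (\<forall>t\<in>pverts T. \<phi> id t = t) \<and>
     (\<forall>\<alpha>\<in>Aut G. \<forall>\<beta>\<in>Aut G. \<forall>t\<in>pverts T. \<phi> (\<beta> \<circ> \<alpha>) t = \<phi> \<beta> (\<phi> \<alpha> t)) \<and>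
     (\<forall>\<alpha>\<in>Aut G. \<forall>t\<in>pverts T. V (\<phi> \<alpha> t) = \<alpha> ` V t))"

text \<open>
  \<open>M s\<close> is the set of nodes contracted to the node \<open>s\<close> of the minor; it is nonempty, as
  \<open>connected\<close> excludes the empty graph. Nodes of the larger graph in no \<open>M s\<close> are deleted.
\<close>

definition minor_model ::
  "'s pair_pre_digraph \<Rightarrow> 't pair_pre_digraph \<Rightarrow> ('s \<Rightarrow> 't set) \<Rightarrow> bool" where
  "minor_model S T M \<longleftrightarrow>
     (\<forall>s\<in>pverts S. M s \<subseteq> pverts T \<and> Digraph_Component.connected (with_proj T \<restriction> M s)) \<and>
     (\<forall>s\<in>pverts S. \<forall>s'\<in>pverts S. s \<noteq> s' \<longrightarrow> M s \<inter> M s' = {}) \<and>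
     (\<forall>(s, s')\<in>parcs S. \<exists>t\<in>M s. \<exists>t'\<in>M s'. (t, t') \<in> parcs T)"

definition td_le ::
  "'s pair_pre_digraph \<Rightarrow> ('s \<Rightarrow> 'a set) \<Rightarrow> 't pair_pre_digraph \<Rightarrow> ('t \<Rightarrow> 'a set) \<Rightarrow> bool" where
  "td_le S W T V \<longleftrightarrow>
     (\<exists>M. minor_model S T M \<and> (\<forall>s\<in>pverts S. W s = (\<Union>t\<in>M s. V t)))"

end

theory Submission
  imports Defs
begin

text \<open>
  The decompositions come from one increasing sequence of nested sets of separations. Two distinct
  \<open>k\<close>-blocks are distinguished by a separation of order at most \<open>k\<close>, so let \<open>l \<le> k\<close> be the least
  order of such a separation. For robust \<open>k\<close>-blocks, the \<open>l\<close>-blocks containing them are again robust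
  (\<open>robust_block_lower\<close>) and still need order \<open>l\<close>. It therefore suffices, for each \<open>k\<close>, to
  distinguish those pairs of robust \<open>k\<close>-blocks that need order exactly \<open>k\<close>, by separations of order
  \<open>k\<close> that are nested with each other and with those of lower order.

  Robustness is what makes the levels compatible. If a distinguishing separation of order \<open>k\<close> crosses
  a separation of lower order, submodularity of the order replaces it by a corner that crosses less,
  unless the two corners on the far side both have very small order; a robust block on that side then
  lies in one of them, and is distinguished by too small an order (\<open>distinguishers_nonempty\<close>).
  Within a level, every pair selects all those of its distinguishers that cross the fewest
  distinguishers of that level. If two selected separations crossed, opposite corners would again
  distinguish the pairs, and together they cross strictly fewer separations
  (\<open>nested_least_crossing\<close>). As all minimisers are selected, automorphisms preserve the result.

  The tree of a nested set \<open>N\<close> has the consistent orientations of \<open>N\<close> as nodes. Adjacent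
  orientations differ in one separation, and each separation is flipped along exactly one edge; this
  is why there are no cycles, why parts along a path intersect as required, and why the
  adhesion sets lie in separators. A \<open>k\<close>-block that no element of \<open>N\<close> splits lies in the part of an
  orientation pointing towards it, and two blocks distinguished by \<open>N\<close> get different parts. Restricting orientations to
  a subset of \<open>N\<close> contracts the edges of the other separations, which yields the minor relation
  (\<open>td_le_if_subset\<close>); automorphisms of the graph act on the orientations.
\<close>

section \<open>Separations\<close>

lemma separation_iff:
  assumes "pair_graph G"
  shows "separation G (A, B) \<longleftrightarrow>
    A \<union> B = pverts G \<and> (\<forall>(u, v)\<in>parcs G. {u, v} \<subseteq> A \<or> {u, v} \<subseteq> B)"
proof -
  interpret pair_graph G by fact
  have "separation G (A, B) \<longleftrightarrow> A \<subseteq> pverts G \<and> B \<subseteq> pverts G \<and> A \<union> B = pverts G \<and>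
      {e \<in> parcs G. fst e \<in> A \<and> snd e \<in> A} \<union> {e \<in> parcs G. fst e \<in> B \<and> snd e \<in> B} = parcs G"
    by (simp add: Digraph_Component.union_def induce_subgraph_def with_proj_def conj_assoc)
  also have "\<dots> \<longleftrightarrow> A \<union> B = pverts G \<and> (\<forall>(u, v)\<in>parcs G. {u, v} \<subseteq> A \<or> {u, v} \<subseteq> B)"
  proof -
    have "{e \<in> parcs G. fst e \<in> A \<and> snd e \<in> A} \<union> {e \<in> parcs G. fst e \<in> B \<and> snd e \<in> B} = parcs G
      \<longleftrightarrow> (\<forall>e\<in>parcs G. (fst e \<in> A \<and> snd e \<in> A) \<or> (fst e \<in> B \<and> snd e \<in> B))"
      by blast
    then show ?thesis by (auto simp: split_beta)
  qed
  finally show ?thesis .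
qed

declare separation.simps [simp del] nested.simps [simp del]

lemma sep_le_iff: "sep_le s t \<longleftrightarrow> fst s \<subseteq> fst t \<and> snd t \<subseteq> snd s"
  by (cases s; cases t) auto

lemma sep_order_eq: "sep_order s = card (fst s \<inter> snd s)"
  by (cases s) auto

lemma nested_iff:
  "nested s t \<longleftrightarrow>
     sep_le s t \<or> sep_le t s \<or> sep_le s (prod.swap t) \<or> sep_le (prod.swap t) s"
  by (cases s; cases t) (auto simp: nested.simps sep_comparable_def)

lemma sep_le_trans: "sep_le r s \<Longrightarrow> sep_le s t \<Longrightarrow> sep_le r t"
  unfolding sep_le_iff by (meson subset_trans)

lemma sep_le_swap_iff [simp]: "sep_le (prod.swap s) (prod.swap t) \<longleftrightarrow> sep_le t s"
  by (auto simp only: sep_le_iff fst_swap snd_swap)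

lemma sep_le_swap_left: "sep_le (prod.swap s) t \<longleftrightarrow> sep_le (prod.swap t) s"
  using sep_le_swap_iff[of s "prod.swap t"] by simp

lemma sep_le_swap_right: "sep_le s (prod.swap t) \<longleftrightarrow> sep_le t (prod.swap s)"
  using sep_le_swap_iff[of "prod.swap s" t] by simp

lemma nested_commute: "nested s t \<longleftrightarrow> nested t s"
  unfolding nested_iff using sep_le_swap_left sep_le_swap_right by blast

lemma nested_swap [simp]:
  "nested s (prod.swap t) \<longleftrightarrow> nested s t" "nested (prod.swap s) t \<longleftrightarrow> nested s t"
proof -
  show "nested s (prod.swap t) \<longleftrightarrow> nested s t" for s t :: "'a sep"
    unfolding nested_iff swap_swap by blast
  then show "nested (prod.swap s) t \<longleftrightarrow> nested s t"
    by (metis nested_commute)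
qed

lemma sep_order_swap [simp]: "sep_order (prod.swap s) = sep_order s"
  by (simp add: sep_order_eq Int_commute)

lemma separation_swap [simp]:
  assumes "pair_graph G"
  shows "separation G (prod.swap s) \<longleftrightarrow> separation G s"
  by (cases s) (auto simp: separation_iff[OF assms])

lemma separation_Un:
  assumes "pair_graph G" "separation G s"
  shows "fst s \<union> snd s = pverts G"
  using assms separation_iff[OF assms(1), of "fst s" "snd s"] by simp

lemma finite_separations:
  assumes "pair_graph G"
  shows "finite {s. separation G s}"
proof -
  interpret pair_graph G by fact
  have "{s. separation G s} \<subseteq> Pow (pverts G) \<times> Pow (pverts G)" by (auto simp: separation.simps)
  then show ?thesis by (rule finite_subset) (simp add: pair_finite_verts)
qed

text \<open>
  The infimum of two separations for \<open>sep_le\<close>: it cuts off the corner \<open>fst s \<inter> fst t\<close>. The other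
  corners arise by swapping \<open>s\<close> or \<open>t\<close>.
\<close>

definition corner :: "'a sep \<Rightarrow> 'a sep \<Rightarrow> 'a sep" where
  "corner s t = (fst s \<inter> fst t, snd s \<union> snd t)"

lemma fst_corner [simp]: "fst (corner s t) = fst s \<inter> fst t"
  and snd_corner [simp]: "snd (corner s t) = snd s \<union> snd t"
  by (simp_all add: corner_def)

lemma corner_le: "sep_le (corner s t) s" "sep_le (corner s t) t"
  unfolding sep_le_iff by simp_all

lemma corner_greatest: "sep_le r s \<Longrightarrow> sep_le r t \<Longrightarrow> sep_le r (corner s t)"
  unfolding sep_le_iff by simp

lemma corner_commute: "corner s t = corner t s"
  by (auto simp: corner_def)

lemma separation_corner:
  assumes "pair_graph G" "separation G s" "separation G t"
  shows "separation G (corner s t)"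
proof -
  obtain A B C D where st: "s = (A, B)" "t = (C, D)" by fastforce
  show ?thesis
    using assms(2,3) unfolding st corner_def fst_conv snd_conv separation_iff[OF assms(1)] by blast
qed

text \<open>
  Both sides count the vertices of the two separators, those in both of them twice.
\<close>

lemma sep_order_corners:
  assumes G: "pair_graph G" "separation G s" "separation G t"
  shows "sep_order (corner s t) + sep_order (corner (prod.swap s) (prod.swap t)) =
    sep_order s + sep_order t"
proof -
  interpret pair_graph G by fact
  obtain A B C D where st: "s = (A, B)" "t = (C, D)" by fastforce
  let ?X = "A \<inter> C \<inter> (B \<union> D)" and ?Y = "B \<inter> D \<inter> (A \<union> C)"
  have AB: "A \<union> B = pverts G" "C \<union> D = pverts G"
    using separation_Un[OF G(1,2)] separation_Un[OF G(1,3)] by (auto simp: st)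
  then have fin: "finite A" "finite B" "finite C" "finite D"
    using pair_finite_verts by (metis finite_Un)+
  have "?X \<union> ?Y = (A \<inter> B) \<union> (C \<inter> D)" "?X \<inter> ?Y = (A \<inter> B) \<inter> (C \<inter> D)"
    using AB by blast+
  then have "card ?X + card ?Y = card (A \<inter> B) + card (C \<inter> D)"
    using card_Un_Int[of ?X ?Y] card_Un_Int[of "A \<inter> B" "C \<inter> D"] fin by simp
  then show ?thesis by (simp add: st corner_def)
qed

text \<open>
  If \<open>s\<close> or its inverse lies above \<open>a\<close> or \<open>b\<close>, it also lies above the corner. Otherwise one of them
  lies below \<open>a\<close> and one below \<open>b\<close>. If it is the same one, it lies below the corner; if not, \<open>s\<close>
  witnesses that \<open>a\<close> and \<open>b\<close> are nested.
\<close>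

lemma nested_corner:
  assumes "crosses a b" "nested s a" "nested s b"
  shows "nested s (corner a b)"
proof (cases "sep_le a s \<or> sep_le a (prod.swap s) \<or> sep_le b s \<or> sep_le b (prod.swap s)")
  case True
  then have "sep_le (corner a b) s \<or> sep_le (corner a b) (prod.swap s)"
    using corner_le sep_le_trans by blast
  then show ?thesis
    unfolding nested_iff using sep_le_swap_right by blast
next
  case False
  then have "sep_le s a \<or> sep_le (prod.swap s) a" "sep_le s b \<or> sep_le (prod.swap s) b"
    using assms(2,3) sep_le_swap_left sep_le_swap_right unfolding nested_iff by blast+
  then consider "sep_le s a" "sep_le s b" | "sep_le (prod.swap s) a" "sep_le (prod.swap s) b"
    | "sep_le (prod.swap b) a"
    using sep_le_swap_left sep_le_trans by blast
  then show ?thesis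
  proof cases
    case 3
    then show ?thesis using assms(1) by (simp add: nested_iff)
  qed (use corner_greatest sep_le_swap_left in \<open>unfold nested_iff, blast+\<close>)
qed

lemma nested_corner_self: "nested a (corner a b)" "nested b (corner a b)"
  by (simp_all add: nested_iff corner_le)

text \<open>
  Up to inversion \<open>s\<close> lies above \<open>a\<close> or above its inverse, and hence above a corner.
\<close>

lemma nested_one_of_opposite_corners:
  assumes "nested s a"
  shows "nested s (corner a b) \<or> nested s (corner (prod.swap a) (prod.swap b))"
proof -
  have below: "nested s (corner c d)" if "sep_le c s \<or> sep_le c (prod.swap s)" for c d
    using that corner_le(1) sep_le_trans sep_le_swap_right unfolding nested_iff by blast
  have "sep_le a s \<or> sep_le a (prod.swap s) \<or> sep_le (prod.swap a) s \<or> sep_le (prod.swap a) (prod.swap s)"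
    using assms sep_le_swap_right[of s a] unfolding nested_iff by auto
  then show ?thesis using below by blast
qed

definition crossing_number :: "'a sep set \<Rightarrow> 'a sep \<Rightarrow> nat" where
  "crossing_number S s = card {t \<in> S. crosses s t}"

lemma crossing_number_swap [simp]: "crossing_number S (prod.swap s) = crossing_number S s"
  by (simp add: crossing_number_def)

text \<open>
  A separation crossing one of two opposite corners crosses \<open>a\<close> or \<open>b\<close>, and one crossing both
  corners crosses both \<open>a\<close> and \<open>b\<close>. The inequality is strict because \<open>a\<close> crosses \<open>b\<close> but no corner.
\<close>

lemma crossing_number_corners_less:
  assumes "finite S" "a \<in> S" "crosses a b"
  shows "crossing_number S (corner a b) + crossing_number S (corner (prod.swap a) (prod.swap b)) <
    crossing_number S a + crossing_number S b"
proof -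
  let ?d = "corner (prod.swap a) (prod.swap b)"
  let ?E = "\<lambda>s. {t \<in> S. crosses s t}"
  have fin: "finite (?E s)" for s using assms(1) by simp
  have "?E (corner a b) \<union> ?E ?d \<subseteq> ?E a \<union> ?E b"
  proof
    fix t assume t: "t \<in> ?E (corner a b) \<union> ?E ?d"
    have "nested t (corner a b) \<and> nested t ?d" if "nested t a" "nested t b"
      using that assms(3) nested_corner[of a b t] nested_corner[of "prod.swap a" "prod.swap b" t]
      by simp
    with t show "t \<in> ?E a \<union> ?E b" by (auto simp: nested_commute)
  qed
  moreover have "a \<in> ?E a \<union> ?E b" using assms(2,3) by (auto simp: nested_commute)
  moreover have "a \<notin> ?E (corner a b) \<union> ?E ?d"
    using nested_corner_self(1)[of a b] nested_corner_self(1)[of "prod.swap a" "prod.swap b"]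
    by (auto simp: nested_commute)
  ultimately have "?E (corner a b) \<union> ?E ?d \<subset> ?E a \<union> ?E b" by blast
  then have 1: "card (?E (corner a b) \<union> ?E ?d) < card (?E a \<union> ?E b)"
    using fin by (intro psubset_card_mono) auto
  have "?E (corner a b) \<inter> ?E ?d \<subseteq> ?E a \<inter> ?E b"
    using nested_one_of_opposite_corners[of _ a b] nested_one_of_opposite_corners[of _ b a]
    by (auto simp: nested_commute corner_commute)
  then have 2: "card (?E (corner a b) \<inter> ?E ?d) \<le> card (?E a \<inter> ?E b)"
    using fin by (intro card_mono) auto
  show ?thesis
    using 1 2 card_Un_Int[OF fin[of a] fin[of b]] card_Un_Int[OF fin[of "corner a b"] fin[of ?d]]
    unfolding crossing_number_def by linarith
qed

section \<open>Inseparable sets and blocks\<close>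

text \<open>
  A set \<open>S\<close> separating \<open>u\<close> from \<open>v\<close> is the separator of a separation: one side consists of \<open>S\<close> and
  the component of \<open>u\<close> in the graph without \<open>S\<close>, the other of everything outside this component.
\<close>

lemma inseparable_iff:
  assumes G: "pair_graph G"
  shows "inseparable G k X \<longleftrightarrow> X \<subseteq> pverts G \<and> k < card X \<and>
    (\<forall>A B. separation G (A, B) \<longrightarrow> sep_order (A, B) \<le> k \<longrightarrow> X \<subseteq> A \<or> X \<subseteq> B)"
    (is "_ \<longleftrightarrow> _ \<and> _ \<and> ?R")
proof -
  interpret pair_graph G by fact
  let ?H = "\<lambda>S. with_proj G \<restriction> (pverts G - S)"
  have H: "verts (?H S) = pverts G - S"
    "arcs_ends (?H S) = {(u, v) \<in> parcs G. u \<notin> S \<and> v \<notin> S}" for S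
    using in_arcsD1 in_arcsD2
    by (auto simp: arcs_ends_conv induce_subgraph_def with_proj_def image_iff)
  have "?R \<longleftrightarrow> \<not> (\<exists>S u v. S \<subseteq> pverts G \<and> card S \<le> k \<and> u \<in> X - S \<and> v \<in> X - S \<and> u \<noteq> v \<and>
          separates G S u v)" if X: "X \<subseteq> pverts G"
  proof
    assume R: ?R
    show "\<not> (\<exists>S u v. S \<subseteq> pverts G \<and> card S \<le> k \<and> u \<in> X - S \<and> v \<in> X - S \<and> u \<noteq> v \<and>
          separates G S u v)"
    proof
      assume "\<exists>S u v. S \<subseteq> pverts G \<and> card S \<le> k \<and> u \<in> X - S \<and> v \<in> X - S \<and> u \<noteq> v \<and>
          separates G S u v"
      then obtain S u v where S: "S \<subseteq> pverts G" "card S \<le> k" "u \<in> X - S" "v \<in> X - S"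
        and sep: "u \<in> pverts G - S" "v \<in> pverts G - S" "\<not> reachable (?H S) u v"
        unfolding separates_def by blast
      define C where "C = {w. reachable (?H S) u w}"
      have CS: "C \<subseteq> pverts G - S"
        unfolding C_def reachable_def using H by (auto dest: in_rtrancl_on_in_F)
      have closed: "y \<in> C" if "x \<in> C" "(x, y) \<in> parcs G" "y \<notin> S" for x y
      proof -
        have "(x, y) \<in> arcs_ends (?H S)" "y \<in> verts (?H S)"
          using that CS in_arcsD2 unfolding H by auto
        then show ?thesis
          using \<open>x \<in> C\<close> unfolding C_def reachable_def by (auto intro: rtrancl_on_into_rtrancl_on)
      qed
      have sepC: "separation G (S \<union> C, pverts G - C)"
        unfolding separation_iff[OF G] using S CS closed
        by (auto dest: in_arcsD1 in_arcsD2 arcs_symmetric)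
      have "(S \<union> C) \<inter> (pverts G - C) = S" using CS S by blast
      then have "sep_order (S \<union> C, pverts G - C) \<le> k" using S by simp
      with R sepC have "X \<subseteq> S \<union> C \<or> X \<subseteq> pverts G - C" by blast
      moreover have "u \<in> C" unfolding C_def reachable_def using sep H by simp
      moreover have "v \<notin> C" using sep by (simp add: C_def)
      ultimately show False using S by blast
    qed
  next
    assume L: "\<not> (\<exists>S u v. S \<subseteq> pverts G \<and> card S \<le> k \<and> u \<in> X - S \<and> v \<in> X - S \<and> u \<noteq> v \<and>
          separates G S u v)"
    show ?R
    proof (intro allI impI, rule ccontr)
      fix A B assume s: "separation G (A, B)" "sep_order (A, B) \<le> k" "\<not> (X \<subseteq> A \<or> X \<subseteq> B)"
      from s(1) have AB: "A \<union> B = pverts G" "\<forall>(u, v)\<in>parcs G. {u, v} \<subseteq> A \<or> {u, v} \<subseteq> B"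
        unfolding separation_iff[OF G] by auto
      obtain u v where uv: "u \<in> X" "u \<notin> B" "v \<in> X" "v \<notin> A" using s(3) by blast
      then have uv': "u \<in> A" "v \<in> B" "u \<in> pverts G" "v \<in> pverts G" using AB X by blast+
      have "w \<in> A - B" if "reachable (?H (A \<inter> B)) u w" for w
        using that unfolding reachable_def
      proof (induction rule: rtrancl_on_induct)
        case base
        then show ?case using uv uv' by blast
      next
        case (step y z)
        then have "(y, z) \<in> parcs G" "z \<notin> A \<inter> B" unfolding H by auto
        with step.IH AB(2) show ?case by blast
      qed
      then have "separates G (A \<inter> B) u v"
        unfolding separates_def using uv uv' by blast
      moreover have "card (A \<inter> B) \<le> k" using s(2) by simp
      moreover have "A \<inter> B \<subseteq> pverts G" "u \<in> X - (A \<inter> B)" "v \<in> X - (A \<inter> B)" "u \<noteq> v"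
        using AB uv uv' by blast+
      ultimately show False using L by blast
    qed
  qed
  then show ?thesis unfolding inseparable_def by blast
qed

lemma inseparable_subset_side:
  assumes "pair_graph G" "inseparable G k X" "separation G s" "sep_order s \<le> k"
  shows "X \<subseteq> fst s \<or> X \<subseteq> snd s"
  using assms(2-) inseparable_iff[OF assms(1)] by (cases s) auto

lemma inseparable_not_subset_small:
  assumes "pair_graph G" "inseparable G k X" "Y \<subseteq> pverts G" "card Y \<le> k"
  shows "\<not> X \<subseteq> Y"
proof
  interpret pair_graph G by fact
  assume "X \<subseteq> Y"
  then have "card X \<le> card Y"
    using finite_subset[OF assms(3) pair_finite_verts] card_mono by blast
  then show False using assms(2,4) by (auto simp: inseparable_def)
qed

lemma inseparable_not_both_sides:
  assumes "pair_graph G" "inseparable G k X" "separation G s" "sep_order s \<le> k"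
  shows "\<not> (X \<subseteq> fst s \<and> X \<subseteq> snd s)"
proof -
  have "fst s \<inter> snd s \<subseteq> pverts G" using separation_Un[OF assms(1,3)] by blast
  then show ?thesis
    using inseparable_not_subset_small[OF assms(1,2), of "fst s \<inter> snd s"] assms(4)
    by (auto simp: sep_order_eq)
qed

lemma inseparable_mono:
  assumes "inseparable G k X" "l \<le> k"
  shows "inseparable G l X"
  using assms unfolding inseparable_def by (meson le_trans le_less_trans)

lemma inseparable_extends_to_block:
  assumes G: "pair_graph G" and X: "inseparable G k X"
  obtains Y where "block G k Y" "X \<subseteq> Y"
proof -
  interpret pair_graph G by fact
  let ?S = "{Y. inseparable G k Y}"
  have "?S \<subseteq> Pow (pverts G)" by (auto simp: inseparable_def)
  then have "finite ?S" using pair_finite_verts finite_subset by blast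
  then obtain Y where "Y \<in> ?S" "X \<subseteq> Y" "\<And>Z. Z \<in> ?S \<Longrightarrow> Y \<subseteq> Z \<Longrightarrow> Z = Y"
    using finite_has_maximal2[of ?S X] X by (metis mem_Collect_eq)
  then show ?thesis using that[of Y] by (auto simp: block_def)
qed

definition distinguishes_sets :: "'a sep \<Rightarrow> 'a set \<Rightarrow> 'a set \<Rightarrow> bool" where
  "distinguishes_sets s X Y \<longleftrightarrow> X \<subseteq> fst s \<and> Y \<subseteq> snd s"

lemma distinguishes_sets_swap: "distinguishes_sets (prod.swap s) X Y \<longleftrightarrow> distinguishes_sets s Y X"
  by (auto simp: distinguishes_sets_def)

text \<open>
  By maximality the union of two distinct blocks is separable, and a separation splitting the union
  splits neither block.
\<close>

lemma blocks_distinguished: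
  assumes G: "pair_graph G" and X: "block G k X" and Y: "block G k Y" and ne: "X \<noteq> Y"
  obtains s where "separation G s" "sep_order s \<le> k" "distinguishes_sets s X Y"
proof -
  interpret pair_graph G by fact
  have iX: "inseparable G k X" and iY: "inseparable G k Y" using X Y by (auto simp: block_def)
  have "\<not> inseparable G k (X \<union> Y)"
    using X Y ne unfolding block_def by blast
  moreover have XY: "X \<union> Y \<subseteq> pverts G" using iX iY by (auto simp: inseparable_def)
  moreover have "k < card (X \<union> Y)"
  proof -
    have "k < card X" using iX by (simp add: inseparable_def)
    also have "\<dots> \<le> card (X \<union> Y)"
      using finite_subset[OF XY pair_finite_verts] by (intro card_mono) auto
    finally show ?thesis .
  qed
  ultimately obtain A B where s: "separation G (A, B)" "sep_order (A, B) \<le> k"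
      "\<not> (X \<union> Y \<subseteq> A)" "\<not> (X \<union> Y \<subseteq> B)"
    using inseparable_iff[OF G, of k "X \<union> Y"] by blast
  have "(X \<subseteq> A \<and> Y \<subseteq> B) \<or> (X \<subseteq> B \<and> Y \<subseteq> A)"
    using inseparable_subset_side[OF G iX s(1,2)] inseparable_subset_side[OF G iY s(1,2)] s(3,4)
    by auto
  then show ?thesis
    using that[of "(A, B)"] that[of "(B, A)"] s separation_swap[OF G, of "(A, B)"]
    by (auto simp: distinguishes_sets_def Int_commute)
qed

section \<open>Robust blocks\<close>

text \<open>
  Robustness for all \<open>K\<close> puts no bound on the order of the crossing separation, and the boundary of
  a corner is the separator of the separation cutting off the corner.
\<close>

lemma robust_block_iff:
  "robust_block G k X \<longleftrightarrow> block G k X \<and>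
     (\<forall>s t. separation G t \<and> sep_order t = k \<and> X \<subseteq> snd t \<and> separation G s \<and> crosses s t \<and>
        sep_order (corner s (prod.swap t)) < k \<and> sep_order (corner (prod.swap s) (prod.swap t)) < k
        \<longrightarrow> X \<subseteq> fst s \<or> X \<subseteq> snd s)"
proof -
  have bd: "boundary (A, B) (C, D) (A \<inter> D) = (A \<inter> D) \<inter> (B \<union> C)"
    "boundary (A, B) (C, D) (B \<inter> D) = (B \<inter> D) \<inter> (A \<union> C)" for A B C D :: "'a set"
    by auto
  have "(\<forall>K. robust G k K X) \<longleftrightarrow> inseparable G k X \<and>
     (\<forall>A B C D.
        separation G (C, D) \<and> sep_order (C, D) = k \<and> X \<subseteq> D \<and>
        separation G (A, B) \<and> crosses (A, B) (C, D) \<and>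
        card ((A \<inter> D) \<inter> (B \<union> C)) < k \<and> card ((B \<inter> D) \<inter> (A \<union> C)) < k
        \<longrightarrow> X \<subseteq> A \<or> X \<subseteq> B)" (is "?L \<longleftrightarrow> _ \<and> ?R")
  proof
    assume L: ?L
    have ?R
    proof (intro allI impI, elim conjE)
      fix A B C D
      show "X \<subseteq> A \<or> X \<subseteq> B" if "separation G (C, D)" "sep_order (C, D) = k" "X \<subseteq> D"
        "separation G (A, B)" "crosses (A, B) (C, D)"
        "card ((A \<inter> D) \<inter> (B \<union> C)) < k" "card ((B \<inter> D) \<inter> (A \<union> C)) < k"
        using L[THEN spec, of "int (sep_order (A, B))"] that unfolding robust_def bd by blast
    qed
    then show "inseparable G k X \<and> ?R" using L unfolding robust_def by blast
  next
    assume R: "inseparable G k X \<and> ?R"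
    then show ?L unfolding robust_def bd by blast
  qed
  then show ?thesis
    unfolding robust_block_def block_def split_paired_all split_paired_All
      corner_def fst_conv snd_conv swap_simp sep_order.simps by blast
qed

text \<open>
  Adding \<open>k - l\<close> vertices of \<open>D - C\<close> to \<open>C\<close> turns an \<open>l\<close>-separation \<open>(C, D)\<close> into a
  \<open>k\<close>-separation and raises the orders of the two corners in \<open>D\<close> by at most \<open>k - l\<close>. So
  the robustness of \<open>U\<close> puts \<open>U\<close> on one side of the crossing separation. The block \<open>W\<close> around
  \<open>U\<close> follows, since it cannot be split by the corner separations, whose orders are less than \<open>l\<close>.
\<close>

lemma robust_block_lower:
  assumes G: "pair_graph G" and U: "robust_block G k U" and "l \<le> k"
    and W: "block G l W" and "U \<subseteq> W"
  shows "robust_block G l W"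
  unfolding robust_block_iff
proof (intro conjI allI impI, rule W)
  interpret pair_graph G by fact
  fix s t
  assume "separation G t \<and> sep_order t = l \<and> W \<subseteq> snd t \<and> separation G s \<and> crosses s t \<and>
    sep_order (corner s (prod.swap t)) < l \<and> sep_order (corner (prod.swap s) (prod.swap t)) < l"
  then have t: "separation G t" "sep_order t = l" "W \<subseteq> snd t"
    and s: "separation G s" and cross: "crosses s t"
    and small: "sep_order (corner s (prod.swap t)) < l"
      "sep_order (corner (prod.swap s) (prod.swap t)) < l"
    by auto
  obtain A B C D where st: "s = (A, B)" "t = (C, D)" by fastforce
  have iU: "inseparable G k U" and iW: "inseparable G l W"
    using U W by (auto simp: block_def robust_block_iff)
  have Un: "A \<union> B = pverts G" "C \<union> D = pverts G"
    using separation_Un[OF G s] separation_Un[OF G t(1)] by (auto simp: st)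
  then have fin: "finite A" "finite B" "finite C" "finite D"
    using pair_finite_verts by (metis finite_Un)+
  have UD: "U \<subseteq> D" using t(3) \<open>U \<subseteq> W\<close> by (auto simp: st)
  have "k < card U" using iU by (simp add: inseparable_def)
  also have "\<dots> \<le> card D" using UD fin by (intro card_mono)
  also have "\<dots> = card (C \<inter> D) + card (D - C)"
    using card_Int_Diff[of D C] fin by (simp add: Int_commute)
  finally have "k - l \<le> card (D - C)" using t(2) by (simp add: st)
  then obtain E where E: "E \<subseteq> D - C" "card E = k - l" "finite E"
    by (meson obtain_subset_with_card_n)
  have sideU: "U \<subseteq> A \<or> U \<subseteq> B"
  proof (rule ccontr)
    assume no: "\<not> (U \<subseteq> A \<or> U \<subseteq> B)"
    let ?t = "(C \<union> E, D)"
    have 1: "separation G ?t"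
      using t(1) E Un unfolding st separation_iff[OF G] by blast
    have "(C \<union> E) \<inter> D = (C \<inter> D) \<union> E" using E by blast
    moreover have "card ((C \<inter> D) \<union> E) = card (C \<inter> D) + card E"
      using E fin by (intro card_Un_disjoint) auto
    ultimately have 2: "sep_order ?t = k" using t(2) E \<open>l \<le> k\<close> by (simp add: st)
    have 3: "crosses s ?t"
      using cross no UD unfolding st nested_iff sep_le_iff by auto
    have bound: "card (K \<inter> D \<inter> (L \<union> (C \<union> E))) < k" if "card (K \<inter> D \<inter> (L \<union> C)) < l"
      and "finite L" for K L
    proof -
      have "card (K \<inter> D \<inter> (L \<union> (C \<union> E))) \<le> card (K \<inter> D \<inter> (L \<union> C) \<union> E)"
        using fin E that by (intro card_mono) auto
      also have "\<dots> \<le> card (K \<inter> D \<inter> (L \<union> C)) + card E" by (rule card_Un_le)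
      finally show ?thesis using that E \<open>l \<le> k\<close> by simp
    qed
    have "sep_order (corner s (prod.swap ?t)) < k" "sep_order (corner (prod.swap s) (prod.swap ?t)) < k"
      using small bound[of A B] bound[of B A] fin by (simp_all add: st corner_def)
    with 1 2 3 s UD U have "U \<subseteq> A \<or> U \<subseteq> B"
      unfolding robust_block_iff by (metis fst_conv snd_conv st(1))
    with no show False ..
  qed
  have follow: "W \<subseteq> fst r" if r: "separation G r" "sep_order (corner r (prod.swap t)) < l" "U \<subseteq> fst r" for r
  proof -
    let ?c = "corner r (prod.swap t)"
    have c: "separation G ?c" using separation_corner[OF G r(1)] t(1) G by simp
    have "U \<subseteq> fst ?c" using r UD by (auto simp: st)
    with inseparable_not_both_sides[OF G iU c] have "\<not> U \<subseteq> snd ?c"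
      using r(2) \<open>l \<le> k\<close> by simp
    then have "\<not> W \<subseteq> snd ?c" using \<open>U \<subseteq> W\<close> by blast
    then show ?thesis using inseparable_subset_side[OF G iW c] r(2) by auto
  qed
  show "W \<subseteq> fst s \<or> W \<subseteq> snd s"
    using sideU follow[OF s small(1)] follow[of "prod.swap s"] s small(2) separation_swap[OF G, of s]
    by (auto simp: st)
qed

section \<open>A canonical nested set of separations\<close>

text \<open>
  Pairs of robust \<open>k\<close>-blocks whose distinction is the task of level \<open>k\<close>: every separation
  distinguishing them has order at least \<open>k\<close>.
\<close>

definition level_pair :: "'a pair_pre_digraph \<Rightarrow> nat \<Rightarrow> 'a set \<Rightarrow> 'a set \<Rightarrow> bool" where
  "level_pair G k X Y \<longleftrightarrow> robust_block G k X \<and> robust_block G k Y \<and> X \<noteq> Y \<and>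
     (\<forall>s. separation G s \<and> distinguishes_sets s X Y \<longrightarrow> k \<le> sep_order s)"

definition distinguishers ::
  "'a pair_pre_digraph \<Rightarrow> nat \<Rightarrow> 'a sep set \<Rightarrow> 'a set \<Rightarrow> 'a set \<Rightarrow> 'a sep set" where
  "distinguishers G k N X Y = {s. separation G s \<and> sep_order s = k \<and> distinguishes_sets s X Y \<and>
     (\<forall>t\<in>N. nested s t)}"

definition level_distinguishers :: "'a pair_pre_digraph \<Rightarrow> nat \<Rightarrow> 'a sep set \<Rightarrow> 'a sep set" where
  "level_distinguishers G k N = {s. \<exists>X Y. level_pair G k X Y \<and> s \<in> distinguishers G k N X Y}"

text \<open>
  A single minimiser could not be chosen canonically, so each pair selects all of them.
\<close>

definition least_crossing :: "'a pair_pre_digraph \<Rightarrow> nat \<Rightarrow> 'a sep set \<Rightarrow> 'a sep set" where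
  "least_crossing G k N = {s. \<exists>X Y. level_pair G k X Y \<and> s \<in> distinguishers G k N X Y \<and>
     (\<forall>t\<in>distinguishers G k N X Y. crossing_number (level_distinguishers G k N) s \<le>
        crossing_number (level_distinguishers G k N) t)}"

text \<open>The separations of order less than \<open>k\<close> of the nested set.\<close>

primrec nested_seps :: "'a pair_pre_digraph \<Rightarrow> nat \<Rightarrow> 'a sep set" where
  "nested_seps G 0 = {}"
| "nested_seps G (Suc k) = nested_seps G k \<union> least_crossing G k (nested_seps G k)"

lemma level_pair_sym:
  assumes "pair_graph G"
  shows "level_pair G k X Y \<longleftrightarrow> level_pair G k Y X"
proof -
  have "level_pair G k Y X" if XY: "level_pair G k X Y" for X Y
  proof -
    have "k \<le> sep_order s" if "separation G s" "distinguishes_sets s Y X" for s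
      using that XY assms distinguishes_sets_swap[of s X Y] separation_swap[OF assms, of s]
      unfolding level_pair_def by (metis sep_order_swap)
    then show ?thesis using XY unfolding level_pair_def by blast
  qed
  then show ?thesis by blast
qed

lemma distinguishers_swap:
  assumes "pair_graph G"
  shows "prod.swap s \<in> distinguishers G k N X Y \<longleftrightarrow> s \<in> distinguishers G k N Y X"
  using assms by (simp add: distinguishers_def distinguishes_sets_swap)

lemma level_distinguishers_swap:
  assumes "pair_graph G"
  shows "prod.swap s \<in> level_distinguishers G k N \<longleftrightarrow> s \<in> level_distinguishers G k N"
  unfolding level_distinguishers_def mem_Collect_eq
  using distinguishers_swap[OF assms] level_pair_sym[OF assms] by blast

lemma least_crossing_swap:
  assumes G: "pair_graph G" and s: "s \<in> least_crossing G k N"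
  shows "prod.swap s \<in> least_crossing G k N"
proof -
  let ?c = "crossing_number (level_distinguishers G k N)"
  obtain X Y where XY: "level_pair G k X Y" "s \<in> distinguishers G k N X Y"
    "\<forall>t\<in>distinguishers G k N X Y. ?c s \<le> ?c t"
    using s unfolding least_crossing_def by blast
  have "?c (prod.swap s) \<le> ?c t" if "t \<in> distinguishers G k N Y X" for t
    using XY(3) that distinguishers_swap[OF G, of t] by (metis crossing_number_swap)
  then show ?thesis
    using XY(1,2) level_pair_sym[OF G] distinguishers_swap[OF G, of s]
    unfolding least_crossing_def by blast
qed

lemma nested_seps_swap:
  assumes "pair_graph G" "s \<in> nested_seps G k"
  shows "prod.swap s \<in> nested_seps G k"
  using assms(2) by (induction k) (auto intro: least_crossing_swap[OF assms(1)])

lemma nested_seps_mono: "k \<le> l \<Longrightarrow> nested_seps G k \<subseteq> nested_seps G l"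
  by (rule lift_Suc_mono_le[of "nested_seps G"]) auto

lemma nested_sepsD:
  assumes "s \<in> nested_seps G k"
  obtains l X Y where "l < k" "level_pair G l X Y" "separation G s" "sep_order s = l"
    "distinguishes_sets s X Y"
proof -
  have "\<exists>l X Y. l < k \<and> level_pair G l X Y \<and> separation G s \<and> sep_order s = l \<and>
    distinguishes_sets s X Y"
    using assms
  proof (induction k)
    case (Suc k)
    then show ?case
      by (auto simp: least_crossing_def distinguishers_def intro: less_SucI)
  qed simp
  then show ?thesis using that by blast
qed

text \<open>
  Suppose \<open>c = corner a b\<close> distinguishes a level pair and the opposite corner \<open>d\<close> distinguishes
  another. Each of them then has order at least \<open>k\<close>, and by submodularity their orders add up to
  \<open>2 k\<close>. So both compete with the distinguishers of their pairs.
\<close>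

lemma level_corners:
  assumes G: "pair_graph G"
    and a: "a \<in> level_distinguishers G k N" and b: "b \<in> level_distinguishers G k N"
    and cross: "crosses a b"
    and PQ: "level_pair G k P Q" "distinguishes_sets (corner a b) P Q"
    and RS: "level_pair G k R S" "distinguishes_sets (corner (prod.swap a) (prod.swap b)) R S"
  shows "corner a b \<in> distinguishers G k N P Q"
    and "corner (prod.swap a) (prod.swap b) \<in> distinguishers G k N R S"
proof -
  let ?c = "corner a b" and ?d = "corner (prod.swap a) (prod.swap b)"
  have ab: "separation G a" "sep_order a = k" "separation G b" "sep_order b = k"
      "\<forall>t\<in>N. nested a t" "\<forall>t\<in>N. nested b t"
    using a b by (auto simp: level_distinguishers_def distinguishers_def)
  have cd: "separation G ?c" "separation G ?d"
    using ab G by (auto intro!: separation_corner)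
  then have "k \<le> sep_order ?c" "k \<le> sep_order ?d"
    using PQ RS unfolding level_pair_def by blast+
  then have ord: "sep_order ?c = k" "sep_order ?d = k"
    using sep_order_corners[OF G ab(1,3)] ab by linarith+
  have "nested ?c t" "nested ?d t" if "t \<in> N" for t
  proof -
    have "nested t a" "nested t b" using that ab(5,6) nested_commute by blast+
    then show "nested ?c t" "nested ?d t"
      using nested_corner[OF cross, of t] nested_corner[of "prod.swap a" "prod.swap b" t] cross
        nested_commute[of t] by auto
  qed
  then show "?c \<in> distinguishers G k N P Q" "?d \<in> distinguishers G k N R S"
    using cd ord PQ(2) RS(2) by (auto simp: distinguishers_def)
qed

lemma finite_level_distinguishers:
  assumes "pair_graph G"
  shows "finite (level_distinguishers G k N)"
proof (rule finite_subset[OF _ finite_separations[OF assms]])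
  show "level_distinguishers G k N \<subseteq> {s. separation G s}"
    unfolding level_distinguishers_def distinguishers_def by blast
qed

text \<open>
  Each of the two pairs lies in opposite corners, or on one side of the other separation. In all
  cases a pair of opposite corners distinguishes the two pairs, one each, unless the pairs
  occupy all four corners; then both corners of one opposite pair distinguish the first pair and both
  corners of the other opposite pair distinguish the second one. The crossing numbers of the corners
  contradict minimality in either case.
\<close>

lemma nested_least_crossing:
  assumes G: "pair_graph G"
    and a: "a \<in> least_crossing G k N" and b: "b \<in> least_crossing G k N"
  shows "nested a b"
proof (rule ccontr)
  assume cross: "crosses a b"
  let ?L = "level_distinguishers G k N"
  let ?m = "crossing_number ?L"
  obtain X X' where X: "level_pair G k X X'" "a \<in> distinguishers G k N X X'"
    "\<forall>t\<in>distinguishers G k N X X'. ?m a \<le> ?m t"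
    using a unfolding least_crossing_def by blast
  obtain Y Y' where Y: "level_pair G k Y Y'" "b \<in> distinguishers G k N Y Y'"
    "\<forall>t\<in>distinguishers G k N Y Y'. ?m b \<le> ?m t"
    using b unfolding least_crossing_def by blast
  have X': "level_pair G k X' X" "\<forall>t\<in>distinguishers G k N X' X. ?m a \<le> ?m t"
    using X level_pair_sym[OF G] distinguishers_swap[OF G]
    by (blast, metis crossing_number_swap)
  have Y': "level_pair G k Y' Y" "\<forall>t\<in>distinguishers G k N Y' Y. ?m b \<le> ?m t"
    using Y level_pair_sym[OF G] distinguishers_swap[OF G]
    by (blast, metis crossing_number_swap)
  have aL: "a \<in> ?L" "prod.swap a \<in> ?L" and bL: "b \<in> ?L" "prod.swap b \<in> ?L"
    using X Y level_distinguishers_swap[OF G] unfolding level_distinguishers_def by blast+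
  have sa: "separation G a" "sep_order a \<le> k" and sb: "separation G b" "sep_order b \<le> k"
    using X Y by (auto simp: distinguishers_def)
  (* The bound n replaces the crossing number of a or of b, so that the contradiction below applies
     to any combination of the two pairs, in any order. *)
  define least where "least n P Q \<longleftrightarrow> level_pair G k P Q \<and> (\<forall>t\<in>distinguishers G k N P Q. n \<le> ?m t)"
    for n P Q
  have least: "least (?m a) X X'" "least (?m a) X' X" "least (?m b) Y Y'" "least (?m b) Y' Y"
    using X X' Y Y' unfolding least_def by blast+
  have corners: False
    if "s = a \<or> s = prod.swap a" "t = b \<or> t = prod.swap b" "least n P Q" "least m R S"
      "P \<subseteq> fst s" "P \<subseteq> fst t" "Q \<subseteq> snd s \<or> Q \<subseteq> snd t"
      "R \<subseteq> snd s" "R \<subseteq> snd t" "S \<subseteq> fst s \<or> S \<subseteq> fst t"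
      "?m a + ?m b \<le> n + m" for s t P Q R S n m
  proof -
    have st: "s \<in> ?L" "t \<in> ?L" "crosses s t" "?m s = ?m a" "?m t = ?m b"
      using that(1,2) aL bL cross by auto
    have "distinguishes_sets (corner s t) P Q"
      "distinguishes_sets (corner (prod.swap s) (prod.swap t)) R S"
      using that(5-10) by (auto simp: distinguishes_sets_def)
    then have "n \<le> ?m (corner s t)" "m \<le> ?m (corner (prod.swap s) (prod.swap t))"
      using level_corners[OF G st(1-3), of P Q R S] that(3,4) unfolding least_def by blast+
    then show False
      using crossing_number_corners_less[OF finite_level_distinguishers[OF G] st(1,3)] st(4,5) that(11)
      by linarith
  qed
  have in_a: "X \<subseteq> fst a" "X' \<subseteq> snd a" and in_b: "Y \<subseteq> fst b" "Y' \<subseteq> snd b"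
    using X(2) Y(2) by (auto simp: distinguishers_def distinguishes_sets_def)
  have "Z \<subseteq> fst s \<or> Z \<subseteq> snd s" if "Z \<in> {X, X', Y, Y'}" "s \<in> {a, b}" for Z s
  proof -
    have "inseparable G k Z"
      using that(1) X(1) Y(1) unfolding level_pair_def robust_block_def block_def by blast
    then show ?thesis using inseparable_subset_side[OF G] sa sb that(2) by blast
  qed
  then have sides: "X \<subseteq> fst b \<or> X \<subseteq> snd b" "X' \<subseteq> fst b \<or> X' \<subseteq> snd b"
    "Y \<subseteq> fst a \<or> Y \<subseteq> snd a" "Y' \<subseteq> fst a \<or> Y' \<subseteq> snd a" by auto
  (* In each use of corners, the pair named first is distinguished by the corner of s and t, the other
     one by the opposite corner. *)
  consider (same) "X \<subseteq> fst b" "X' \<subseteq> fst b" | (same') "X \<subseteq> snd b" "X' \<subseteq> snd b"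
    | (opp) "X \<subseteq> fst b" "X' \<subseteq> snd b" | (opp') "X \<subseteq> snd b" "X' \<subseteq> fst b"
    using sides(1,2) by blast
  then show False
  proof cases
    case same
    consider "Y \<subseteq> fst a" "Y' \<subseteq> fst a" | "Y \<subseteq> snd a" "Y' \<subseteq> snd a"
      | "Y \<subseteq> fst a" "Y' \<subseteq> snd a" | "Y \<subseteq> snd a" "Y' \<subseteq> fst a"
      using sides(3,4) by blast
    then show False
    proof cases
      case 1
      show False
        using corners[of "prod.swap a" b "?m a" X' X "?m b" Y' Y] 1 same in_a in_b least by simp
    next
      case 2
      show False
        using corners[of a b "?m a" X X' "?m b" Y' Y] 2 same in_a in_b least by simp
    next
      case 3
      show False
        using corners[of a b "?m a" X X' "?m b" Y' Y] 3 same in_a in_b least by simp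
    next
      case 4
      show False
        using corners[of "prod.swap a" b "?m a" X' X "?m b" Y' Y] 4 same in_a in_b least by simp
    qed
  next
    case same'
    consider "Y \<subseteq> fst a" "Y' \<subseteq> fst a" | "Y \<subseteq> snd a" "Y' \<subseteq> snd a"
      | "Y \<subseteq> fst a" "Y' \<subseteq> snd a" | "Y \<subseteq> snd a" "Y' \<subseteq> fst a"
      using sides(3,4) by blast
    then show False
    proof cases
      case 1
      show False
        using corners[of "prod.swap a" "prod.swap b" "?m a" X' X "?m b" Y Y'] 1 same' in_a in_b least by simp
    next
      case 2
      show False
        using corners[of a "prod.swap b" "?m a" X X' "?m b" Y Y'] 2 same' in_a in_b least by simp
    next
      case 3
      show False
        using corners[of a b "?m b" Y Y' "?m a" X' X] 3 same' in_a in_b least by simp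
    next
      case 4
      show False
        using corners[of "prod.swap a" b "?m b" Y Y' "?m a" X X'] 4 same' in_a in_b least by simp
    qed
  next
    case opp
    consider "Y \<subseteq> fst a" "Y' \<subseteq> fst a" | "Y' \<subseteq> snd a" | "Y \<subseteq> snd a" "Y' \<subseteq> fst a"
      using sides(3,4) by blast
    then show False
    proof cases
      case 1
      show False
        using corners[of a b "?m b" Y Y' "?m a" X' X] 1 opp in_a in_b least by simp
    next
      case 2
      show False
        using corners[of a b "?m a" X X' "?m b" Y' Y] 2 opp in_a in_b least by simp
    next
      case 3
      show False
        using linear[of "?m b" "?m a"]
      proof
        assume "?m b \<le> ?m a"
        then show False
          using corners[of a b "?m a" X X' "?m a" X' X] 3 opp in_a in_b least by simp
      next
        assume "?m a \<le> ?m b"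
        then show False
          using corners[of "prod.swap a" b "?m b" Y Y' "?m b" Y' Y] 3 opp in_a in_b least by simp
      qed
    qed
  next
    case opp'
    consider "Y \<subseteq> fst a" "Y' \<subseteq> fst a" | "Y \<subseteq> snd a" | "Y \<subseteq> fst a" "Y' \<subseteq> snd a"
      using sides(3,4) by blast
    then show False
    proof cases
      case 1
      show False
        using corners[of a "prod.swap b" "?m b" Y' Y "?m a" X' X] 1 opp' in_a in_b least by simp
    next
      case 2
      show False
        using corners[of a "prod.swap b" "?m a" X X' "?m b" Y Y'] 2 opp' in_a in_b least by simp
    next
      case 3
      show False
        using linear[of "?m b" "?m a"]
      proof
        assume "?m b \<le> ?m a"
        then show False
          using corners[of a "prod.swap b" "?m a" X X' "?m a" X' X] 3 opp' in_a in_b least by simp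
      next
        assume "?m a \<le> ?m b"
        then show False
          using corners[of a b "?m b" Y Y' "?m b" Y' Y] 3 opp' in_a in_b least by simp
      qed
    qed
  qed
qed

lemma finite_nested_seps:
  assumes "pair_graph G"
  shows "finite (nested_seps G k)"
proof (rule finite_subset[OF _ finite_separations[OF assms]])
  show "nested_seps G k \<subseteq> {s. separation G s}"
    using nested_sepsD by blast
qed

lemma nested_seps_nested:
  assumes G: "pair_graph G" and "s \<in> nested_seps G k" "t \<in> nested_seps G k"
  shows "nested s t"
  using assms(2,3)
proof (induction k arbitrary: s t)
  case (Suc k)
  have new: "nested s t" if "s \<in> least_crossing G k (nested_seps G k)" "t \<in> nested_seps G k" for s t
    using that unfolding least_crossing_def distinguishers_def by blast
  from Suc.prems consider "s \<in> nested_seps G k" "t \<in> nested_seps G k"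
    | "s \<in> nested_seps G k" "t \<in> least_crossing G k (nested_seps G k)"
    | "s \<in> least_crossing G k (nested_seps G k)" "t \<in> nested_seps G k"
    | "s \<in> least_crossing G k (nested_seps G k)" "t \<in> least_crossing G k (nested_seps G k)"
    unfolding nested_seps.simps by blast
  then show ?case
  proof cases
    case 1 then show ?thesis by (rule Suc.IH)
  next
    case 2 then show ?thesis using new nested_commute by blast
  next
    case 3 then show ?thesis using new by blast
  next
    case 4 then show ?thesis by (rule nested_least_crossing[OF G])
  qed
qed simp

text \<open>
  Among all distinguishers of order \<open>k\<close> choose one, \<open>s\<close>, crossing as few earlier separations as
  possible. Suppose that it crosses \<open>t\<close>, of order \<open>l < k\<close>, whose first side contains \<open>X\<close> and
  \<open>Y\<close>. The corners on this side distinguish \<open>X\<close> from \<open>Y\<close>; by the choice of \<open>s\<close> they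
  have order greater than \<open>k\<close>, so the corners on the other side have order less than \<open>l\<close>. By
  robustness, \<open>s\<close> does not split the \<open>l\<close>-block \<open>W\<close> on that side of the pair for which \<open>t\<close> was
  selected. So \<open>W\<close> lies in one of these corners, and an order less than \<open>l\<close> suffices to
  distinguish the pair.
\<close>

lemma distinguishers_nonempty:
  assumes G: "pair_graph G" and XY: "level_pair G k X Y" "separation G s\<^sub>0" "sep_order s\<^sub>0 = k"
      "distinguishes_sets s\<^sub>0 X Y"
  shows "distinguishers G k (nested_seps G k) X Y \<noteq> {}"
proof -
  let ?N = "nested_seps G k"
  let ?m = "crossing_number ?N"
  let ?D = "\<lambda>s P Q. separation G s \<and> sep_order s = k \<and> distinguishes_sets s P Q"
  have fin: "finite ?N"
    by (rule finite_nested_seps[OF G])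
  obtain s where s: "?D s X Y" and min: "\<And>t. ?D t X Y \<Longrightarrow> ?m s \<le> ?m t"
    using XY(2-4) ex_has_least_nat[of "\<lambda>s. ?D s X Y" s\<^sub>0 ?m] by blast
  have "nested s t\<^sub>0" if t\<^sub>0: "t\<^sub>0 \<in> ?N" for t\<^sub>0
  proof (rule ccontr)
    assume cross\<^sub>0: "crosses s t\<^sub>0"
    obtain l U\<^sub>0 W\<^sub>0 where lUW: "l < k" "level_pair G l U\<^sub>0 W\<^sub>0" "separation G t\<^sub>0" "sep_order t\<^sub>0 = l"
      "distinguishes_sets t\<^sub>0 U\<^sub>0 W\<^sub>0"
      using nested_sepsD[OF t\<^sub>0] .
    have no_pair: "\<not> distinguishes_sets t\<^sub>0 P Q" if "level_pair G k P Q" for P Q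
    proof
      assume "distinguishes_sets t\<^sub>0 P Q"
      then have "k \<le> sep_order t\<^sub>0" using that lUW(3) unfolding level_pair_def by blast
      then show False using lUW(1,4) by simp
    qed
    have no: "\<not> distinguishes_sets t\<^sub>0 X Y" "\<not> distinguishes_sets t\<^sub>0 Y X"
      using no_pair XY(1) level_pair_sym[OF G] by blast+
    have "inseparable G k X" "inseparable G k Y"
      using XY(1) unfolding level_pair_def robust_block_def block_def by blast+
    then have "X \<subseteq> fst t\<^sub>0 \<or> X \<subseteq> snd t\<^sub>0" "Y \<subseteq> fst t\<^sub>0 \<or> Y \<subseteq> snd t\<^sub>0"
      using inseparable_subset_side[OF G _ lUW(3)] lUW(1,4) by (metis less_imp_le)+
    then have "(X \<subseteq> fst t\<^sub>0 \<and> Y \<subseteq> fst t\<^sub>0) \<or> (X \<subseteq> snd t\<^sub>0 \<and> Y \<subseteq> snd t\<^sub>0)"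
      using no unfolding distinguishes_sets_def by blast
    then obtain t U W where t: "t = t\<^sub>0 \<or> t = prod.swap t\<^sub>0" "X \<subseteq> fst t" "Y \<subseteq> fst t"
      "level_pair G l U W" "distinguishes_sets t U W"
    proof
      assume "X \<subseteq> fst t\<^sub>0 \<and> Y \<subseteq> fst t\<^sub>0"
      then show thesis using that[of t\<^sub>0 U\<^sub>0 W\<^sub>0] lUW by blast
    next
      assume "X \<subseteq> snd t\<^sub>0 \<and> Y \<subseteq> snd t\<^sub>0"
      then show thesis
        using that[of "prod.swap t\<^sub>0" W\<^sub>0 U\<^sub>0] lUW level_pair_sym[OF G] distinguishes_sets_swap
        by (metis fst_swap)
    qed
    have tN: "t \<in> ?N" using t(1) t\<^sub>0 nested_seps_swap[OF G] by blast
    have tt: "separation G t" "sep_order t = l" "crosses s t"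
      using t(1) lUW cross\<^sub>0 separation_swap[OF G, of t\<^sub>0] by auto
    have small: "sep_order (corner (prod.swap t) (prod.swap r)) < l"
      if r: "?D r P Q" "level_pair G k P Q" "P \<subseteq> fst t" "crosses t r"
        and min: "\<And>u. ?D u P Q \<Longrightarrow> ?m r \<le> ?m u" for r P Q
    proof -
      let ?c = "corner t r"
      have c: "separation G ?c" "distinguishes_sets ?c P Q"
        using r tt separation_corner[OF G] by (auto simp: distinguishes_sets_def)
      then have "k \<le> sep_order ?c" using r(2) unfolding level_pair_def by blast
      moreover have "sep_order ?c \<noteq> k"
      proof
        assume "sep_order ?c = k"
        then have "?m r \<le> ?m ?c" using min c by blast
        moreover have "{u \<in> ?N. crosses ?c u} \<subset> {u \<in> ?N. crosses r u}"
        proof -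
          have "nested ?c u" if "u \<in> ?N" "nested r u" for u
            using nested_corner[OF r(4), of u] nested_seps_nested[OF G that(1) tN] that(2)
            by (simp add: nested_commute)
          moreover have "nested ?c t" using nested_corner_self(1)[of t r] by (simp add: nested_commute)
          moreover have "crosses r t" using r(4) by (simp add: nested_commute)
          ultimately show ?thesis using tN by blast
        qed
        then have "?m ?c < ?m r"
          unfolding crossing_number_def using fin by (intro psubset_card_mono) auto
        ultimately show False by simp
      qed
      moreover have "sep_order ?c + sep_order (corner (prod.swap t) (prod.swap r)) = l + k"
        using sep_order_corners[OF G, of t r] tt r by simp
      ultimately show ?thesis by linarith
    qed
    have small1: "sep_order (corner (prod.swap s) (prod.swap t)) < l"
      using small[of s X Y] s XY(1) t(2) tt(3) min
      by (simp add: nested_commute corner_commute)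
    have min': "?m (prod.swap s) \<le> ?m u" if "?D u Y X" for u
      using min[of "prod.swap u"] that G by (simp add: distinguishes_sets_swap)
    have small2: "sep_order (corner s (prod.swap t)) < l"
      using small[of "prod.swap s" Y X] s XY(1) level_pair_sym[OF G, of k X Y] t(3) tt(3) min' G
      by (simp add: nested_commute corner_commute distinguishes_sets_swap)
    have UW: "U \<subseteq> fst t" "W \<subseteq> snd t" using t(5) by (auto simp: distinguishes_sets_def)
    have "robust_block G l W" using t(4) by (simp add: level_pair_def)
    then have "W \<subseteq> fst s \<or> W \<subseteq> snd s"
      using small1 small2 tt s UW(2) unfolding robust_block_iff by blast
    then obtain r where r: "r = s \<or> r = prod.swap s" "W \<subseteq> fst r"
      by (metis fst_swap)
    let ?c = "corner r (prod.swap t)"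
    have "separation G ?c" "sep_order ?c < l"
      using r(1) s tt small1 small2 G by (auto intro!: separation_corner)
    moreover have "distinguishes_sets ?c W U" using r(2) UW by (auto simp: distinguishes_sets_def)
    ultimately show False
      using level_pair_sym[OF G, of l U W] t(4) leD unfolding level_pair_def by blast
  qed
  then show ?thesis using s unfolding distinguishers_def by blast
qed

text \<open>
  If \<open>l\<close> is the least order of a separation distinguishing \<open>X\<close> from \<open>Y\<close>, the \<open>l\<close>-blocks
  around \<open>X\<close> and \<open>Y\<close> are distinct, robust and a level pair.
\<close>

lemma nested_seps_distinguish:
  assumes G: "pair_graph G" and X: "robust_block G k X" and Y: "robust_block G k Y" and "X \<noteq> Y"
  obtains s where "s \<in> nested_seps G (Suc k)" "distinguishes_sets s X Y"
proof -
  have bX: "block G k X" "inseparable G k X" and bY: "block G k Y" "inseparable G k Y"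
    using X Y by (auto simp: robust_block_def block_def)
  obtain s\<^sub>0 where s\<^sub>0: "separation G s\<^sub>0" "sep_order s\<^sub>0 \<le> k" "distinguishes_sets s\<^sub>0 X Y"
    using blocks_distinguished[OF G bX(1) bY(1) \<open>X \<noteq> Y\<close>] .
  obtain s where s: "separation G s" "distinguishes_sets s X Y"
    and min: "\<And>t. separation G t \<Longrightarrow> distinguishes_sets t X Y \<Longrightarrow> sep_order s \<le> sep_order t"
    using ex_has_least_nat[of "\<lambda>s. separation G s \<and> distinguishes_sets s X Y" s\<^sub>0 sep_order] s\<^sub>0 by blast
  define l where "l = sep_order s"
  have lk: "l \<le> k" using min[OF s\<^sub>0(1,3)] s\<^sub>0(2) by (simp add: l_def)
  obtain X' where X': "block G l X'" "X \<subseteq> X'"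
    using inseparable_extends_to_block[OF G inseparable_mono[OF bX(2) lk]] .
  obtain Y' where Y': "block G l Y'" "Y \<subseteq> Y'"
    using inseparable_extends_to_block[OF G inseparable_mono[OF bY(2) lk]] .
  have iX': "inseparable G l X'" and iY': "inseparable G l Y'" using X' Y' by (auto simp: block_def)
  have "X' \<subseteq> fst s"
    using inseparable_subset_side[OF G iX' s(1)] inseparable_not_both_sides[OF G bX(2) s(1)]
      s(2) X'(2) lk by (auto simp: l_def distinguishes_sets_def)
  moreover have "Y' \<subseteq> snd s"
    using inseparable_subset_side[OF G iY' s(1)] inseparable_not_both_sides[OF G bY(2) s(1)]
      s(2) Y'(2) lk by (auto simp: l_def distinguishes_sets_def)
  ultimately have dist: "distinguishes_sets s X' Y'" and ne: "X' \<noteq> Y'"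
    using inseparable_not_both_sides[OF G iX' s(1)] by (auto simp: l_def distinguishes_sets_def)
  have weaker: "distinguishes_sets t X Y" if "distinguishes_sets t X' Y'" for t
    using that X'(2) Y'(2) unfolding distinguishes_sets_def by blast
  have pair: "level_pair G l X' Y'"
    using robust_block_lower[OF G X lk X'] robust_block_lower[OF G Y lk Y'] ne min weaker
    unfolding level_pair_def l_def by blast
  let ?N = "nested_seps G l"
  obtain t\<^sub>0 where "t\<^sub>0 \<in> distinguishers G l ?N X' Y'"
    using distinguishers_nonempty[OF G pair s(1) _ dist] l_def by blast
  then obtain t where "t \<in> distinguishers G l ?N X' Y'"
    "\<forall>u\<in>distinguishers G l ?N X' Y'. crossing_number (level_distinguishers G l ?N) t \<le>
       crossing_number (level_distinguishers G l ?N) u"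
    using ex_has_least_nat[of "\<lambda>t. t \<in> distinguishers G l ?N X' Y'" t\<^sub>0
      "crossing_number (level_distinguishers G l ?N)"] by blast
  then have "t \<in> nested_seps G (Suc l)" "distinguishes_sets t X' Y'"
    using pair by (auto simp: least_crossing_def distinguishers_def)
  then show ?thesis
    using that weaker nested_seps_mono[of "Suc l" "Suc k" G] lk by blast
qed

section \<open>Invariance under automorphisms\<close>

definition act :: "('a \<Rightarrow> 'a) \<Rightarrow> 'a sep \<Rightarrow> 'a sep" where
  "act \<alpha> s = (\<alpha> ` fst s, \<alpha> ` snd s)"

lemma fst_act [simp]: "fst (act \<alpha> s) = \<alpha> ` fst s"
  and snd_act [simp]: "snd (act \<alpha> s) = \<alpha> ` snd s"
  by (simp_all add: act_def)

lemma act_swap: "act \<alpha> (prod.swap s) = prod.swap (act \<alpha> s)"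
  by (simp add: act_def prod_eq_iff)

lemma act_comp: "act (\<beta> \<circ> \<alpha>) s = act \<beta> (act \<alpha> s)"
  by (simp add: act_def image_comp)

lemma act_id: "act id s = s"
  by (simp add: act_def)

lemma inj_act: "inj \<alpha> \<Longrightarrow> inj (act \<alpha>)"
  by (auto intro!: injI simp: act_def inj_image_eq_iff prod_eq_iff)

lemma sep_le_act: "inj \<alpha> \<Longrightarrow> sep_le (act \<alpha> s) (act \<alpha> t) \<longleftrightarrow> sep_le s t"
  by (simp add: sep_le_iff inj_image_subset_iff)

lemma nested_act: "inj \<alpha> \<Longrightarrow> nested (act \<alpha> s) (act \<alpha> t) \<longleftrightarrow> nested s t"
  by (simp add: nested_iff sep_le_act flip: act_swap)

lemma act_corner: "inj \<alpha> \<Longrightarrow> corner (act \<alpha> s) (act \<alpha> t) = act \<alpha> (corner s t)"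
  by (simp add: corner_def act_def image_Int image_Un)

lemma sep_order_act: "inj \<alpha> \<Longrightarrow> sep_order (act \<alpha> s) = sep_order s"
  by (simp add: sep_order_eq card_image inj_on_subset flip: image_Int)

lemma distinguishes_sets_act:
  "inj \<alpha> \<Longrightarrow> distinguishes_sets (act \<alpha> s) (\<alpha> ` X) (\<alpha> ` Y) \<longleftrightarrow> distinguishes_sets s X Y"
  by (simp add: distinguishes_sets_def inj_image_subset_iff)

lemma Aut_inj: "\<alpha> \<in> Aut G \<Longrightarrow> inj \<alpha>"
  by (auto simp: Aut_def permutes_inj)

lemma Aut_inv:
  assumes "\<alpha> \<in> Aut G"
  shows "inv \<alpha> \<in> Aut G" "inv \<alpha> \<circ> \<alpha> = id" "\<alpha> \<circ> inv \<alpha> = id"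
proof -
  have p: "\<alpha> permutes pverts G" using assms by (simp add: Aut_def)
  show "inv \<alpha> \<circ> \<alpha> = id" "\<alpha> \<circ> inv \<alpha> = id"
    using permutes_inv_o[OF p] by simp_all
  have "(inv \<alpha> u, inv \<alpha> v) \<in> parcs G \<longleftrightarrow> (u, v) \<in> parcs G" if "u \<in> pverts G" "v \<in> pverts G" for u v
  proof -
    have "inv \<alpha> u \<in> pverts G" "inv \<alpha> v \<in> pverts G"
      using that permutes_inv[OF p] by (simp_all add: permutes_in_image)
    then have "(\<alpha> (inv \<alpha> u), \<alpha> (inv \<alpha> v)) \<in> parcs G \<longleftrightarrow> (inv \<alpha> u, inv \<alpha> v) \<in> parcs G"
      using assms by (simp add: Aut_def)
    then show ?thesis by (simp add: permutes_inverses[OF p])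
  qed
  then show "inv \<alpha> \<in> Aut G" using permutes_inv[OF p] by (simp add: Aut_def)
qed

lemma Aut_image_cancel:
  assumes "\<alpha> \<in> Aut G"
  shows "inv \<alpha> ` \<alpha> ` X = X" "\<alpha> ` inv \<alpha> ` X = X" "act (inv \<alpha>) (act \<alpha> s) = s"
    "act \<alpha> (act (inv \<alpha>) s) = s"
  using Aut_inv(2,3)[OF assms] by (simp_all add: image_comp act_id flip: act_comp)

lemma Aut_image_pverts: "\<alpha> \<in> Aut G \<Longrightarrow> \<alpha> ` pverts G = pverts G"
  by (auto simp: Aut_def permutes_image)

text \<open>
  Automorphisms form a group, so that invariance of a property in one direction suffices.
\<close>

lemma Aut_invariantI:
  assumes "\<And>\<alpha> x. \<alpha> \<in> Aut G \<Longrightarrow> P x \<Longrightarrow> P (f \<alpha> x)" "\<And>\<alpha> x. \<alpha> \<in> Aut G \<Longrightarrow> f (inv \<alpha>) (f \<alpha> x) = x"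
    and "\<alpha> \<in> Aut G"
  shows "P (f \<alpha> x) \<longleftrightarrow> P x"
  using assms Aut_inv(1) by metis

lemma separation_act:
  assumes G: "pair_graph G" and "\<alpha> \<in> Aut G"
  shows "separation G (act \<alpha> s) \<longleftrightarrow> separation G s"
proof (rule Aut_invariantI[where P = "separation G" and f = act, OF _ Aut_image_cancel(3) assms(2)])
  interpret pair_graph G by fact
  fix \<alpha> s assume \<alpha>: "\<alpha> \<in> Aut G" and s: "separation G s"
  obtain A B where AB: "s = (A, B)" by fastforce
  have "A \<union> B = pverts G" and arcs: "\<forall>(u, v)\<in>parcs G. {u, v} \<subseteq> A \<or> {u, v} \<subseteq> B"
    using s separation_iff[OF G, of A B] by (simp_all add: AB)
  then have "\<alpha> ` A \<union> \<alpha> ` B = pverts G" using Aut_image_pverts[OF \<alpha>] by (metis image_Un)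
  moreover have "{u, v} \<subseteq> \<alpha> ` A \<or> {u, v} \<subseteq> \<alpha> ` B" if uv: "(u, v) \<in> parcs G" for u v
  proof -
    obtain x y where xy: "u = \<alpha> x" "v = \<alpha> y" "x \<in> pverts G" "y \<in> pverts G"
      using in_arcsD1[OF uv] in_arcsD2[OF uv] Aut_image_pverts[OF \<alpha>] by (metis imageE)
    then have "(x, y) \<in> parcs G" using uv \<alpha> by (simp add: Aut_def)
    then show ?thesis using arcs xy by blast
  qed
  ultimately show "separation G (act \<alpha> s)"
    unfolding AB act_def fst_conv snd_conv separation_iff[OF G] by blast
qed auto

lemma inseparable_image:
  assumes G: "pair_graph G" and "\<alpha> \<in> Aut G"
  shows "inseparable G k (\<alpha> ` X) \<longleftrightarrow> inseparable G k X"
proof (rule Aut_invariantI[where P = "inseparable G k" and f = image, OF _ Aut_image_cancel(1) assms(2)])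
  fix \<alpha> X assume \<alpha>: "\<alpha> \<in> Aut G" and X: "inseparable G k X"
  note inj = Aut_inj[OF \<alpha>]
  have "\<alpha> ` X \<subseteq> pverts G" using X Aut_image_pverts[OF \<alpha>] unfolding inseparable_def by blast
  moreover have "k < card (\<alpha> ` X)"
    using X inj by (simp add: inseparable_def card_image inj_on_subset)
  moreover have "\<alpha> ` X \<subseteq> fst s \<or> \<alpha> ` X \<subseteq> snd s" if s: "separation G s" "sep_order s \<le> k" for s
  proof -
    let ?t = "act (inv \<alpha>) s"
    have "separation G ?t" "sep_order ?t \<le> k"
      using s separation_act[OF G Aut_inv(1)[OF \<alpha>], of s] sep_order_act[OF Aut_inj[OF Aut_inv(1)[OF \<alpha>]]]
      by simp_all
    then have "X \<subseteq> fst ?t \<or> X \<subseteq> snd ?t" by (rule inseparable_subset_side[OF G X])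
    then have "\<alpha> ` X \<subseteq> fst (act \<alpha> ?t) \<or> \<alpha> ` X \<subseteq> snd (act \<alpha> ?t)"
      using inj by (simp only: fst_act snd_act inj_image_subset_iff)
    then show ?thesis by (simp only: Aut_image_cancel(4)[OF \<alpha>])
  qed
  ultimately show "inseparable G k (\<alpha> ` X)"
    unfolding inseparable_iff[OF G] by (metis fst_conv snd_conv)
qed auto

lemma block_image:
  assumes G: "pair_graph G" and "\<alpha> \<in> Aut G"
  shows "block G k (\<alpha> ` X) \<longleftrightarrow> block G k X"
proof (rule Aut_invariantI[where P = "block G k" and f = image, OF _ Aut_image_cancel(1) assms(2)])
  fix \<alpha> X assume \<alpha>: "\<alpha> \<in> Aut G" and X: "block G k X"
  have "Y = \<alpha> ` X" if Y: "inseparable G k Y" "\<alpha> ` X \<subseteq> Y" for Y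
  proof -
    have "inv \<alpha> ` \<alpha> ` X \<subseteq> inv \<alpha> ` Y" using Y(2) by (rule image_mono)
    then have "X \<subseteq> inv \<alpha> ` Y" by (simp only: Aut_image_cancel(1)[OF \<alpha>])
    moreover have "inseparable G k (inv \<alpha> ` Y)"
      using Y(1) inseparable_image[OF G Aut_inv(1)[OF \<alpha>]] by blast
    ultimately have "inv \<alpha> ` Y = X" using X by (auto simp: block_def)
    then show ?thesis using Aut_image_cancel(2)[OF \<alpha>] by metis
  qed
  then show "block G k (\<alpha> ` X)"
    using X inseparable_image[OF G \<alpha>] by (auto simp: block_def)
qed auto

text \<open>
  The separations to be considered for the image are pulled back along the automorphism.
\<close>

lemma robust_block_image:
  assumes G: "pair_graph G" and "\<alpha> \<in> Aut G"
  shows "robust_block G k (\<alpha> ` X) \<longleftrightarrow> robust_block G k X"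
proof (rule Aut_invariantI[where P = "robust_block G k" and f = image, OF _ Aut_image_cancel(1) assms(2)])
  fix \<alpha> X assume \<alpha>: "\<alpha> \<in> Aut G" and X: "robust_block G k X"
  let ?b = "act (inv \<alpha>)"
  note \<beta> = Aut_inv(1)[OF \<alpha>]
  note inj = Aut_inj[OF \<beta>]
  have "\<alpha> ` X \<subseteq> fst s \<or> \<alpha> ` X \<subseteq> snd s"
    if *: "separation G t \<and> sep_order t = k \<and> \<alpha> ` X \<subseteq> snd t \<and> separation G s \<and> crosses s t \<and>
      sep_order (corner s (prod.swap t)) < k \<and> sep_order (corner (prod.swap s) (prod.swap t)) < k"
    for s t
  proof -
    have "inv \<alpha> ` \<alpha> ` X \<subseteq> inv \<alpha> ` snd t" using * by (intro image_mono) simp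
    then have "X \<subseteq> snd (?b t)" by (simp only: Aut_image_cancel(1)[OF \<alpha>] snd_act)
    then have "separation G (?b t) \<and> sep_order (?b t) = k \<and> X \<subseteq> snd (?b t) \<and> separation G (?b s) \<and>
      crosses (?b s) (?b t) \<and> sep_order (corner (?b s) (prod.swap (?b t))) < k \<and>
      sep_order (corner (prod.swap (?b s)) (prod.swap (?b t))) < k"
      using * separation_act[OF G \<beta>, of t] separation_act[OF G \<beta>, of s]
      by (simp add: act_corner[OF inj] sep_order_act[OF inj] nested_act[OF inj] flip: act_swap del: snd_act)
    then have "X \<subseteq> fst (?b s) \<or> X \<subseteq> snd (?b s)"
      using X unfolding robust_block_iff by blast
    then have "\<alpha> ` X \<subseteq> fst (act \<alpha> (?b s)) \<or> \<alpha> ` X \<subseteq> snd (act \<alpha> (?b s))"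
      using Aut_inj[OF \<alpha>] by (simp only: fst_act snd_act inj_image_subset_iff)
    then show ?thesis by (simp only: Aut_image_cancel(4)[OF \<alpha>])
  qed
  moreover have "block G k (\<alpha> ` X)" using X block_image[OF G \<alpha>] by (simp add: robust_block_def)
  ultimately show "robust_block G k (\<alpha> ` X)" unfolding robust_block_iff by blast
qed auto

lemma level_pair_image:
  assumes G: "pair_graph G" and \<alpha>: "\<alpha> \<in> Aut G" and XY: "level_pair G k X Y"
  shows "level_pair G k (\<alpha> ` X) (\<alpha> ` Y)"
proof -
  have "k \<le> sep_order s" if s: "separation G s" "distinguishes_sets s (\<alpha> ` X) (\<alpha> ` Y)" for s
  proof -
    let ?t = "act (inv \<alpha>) s"
    note \<beta> = Aut_inv(1)[OF \<alpha>]
    have "distinguishes_sets ?t X Y"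
      using distinguishes_sets_act[OF Aut_inj[OF \<alpha>], of ?t X Y] s(2)
      by (simp only: Aut_image_cancel(4)[OF \<alpha>])
    moreover have "separation G ?t" using s(1) separation_act[OF G \<beta>] by blast
    ultimately have "k \<le> sep_order ?t" using XY unfolding level_pair_def by blast
    then show ?thesis by (simp only: sep_order_act[OF Aut_inj[OF \<beta>]])
  qed
  then show ?thesis
    using XY robust_block_image[OF G \<alpha>] inj_image_eq_iff[OF Aut_inj[OF \<alpha>], of X Y]
    unfolding level_pair_def by blast
qed

lemma distinguishers_act:
  assumes G: "pair_graph G" and \<alpha>: "\<alpha> \<in> Aut G" and N: "\<And>\<beta> t. \<beta> \<in> Aut G \<Longrightarrow> t \<in> N \<Longrightarrow> act \<beta> t \<in> N"
    and s: "s \<in> distinguishers G k N X Y"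
  shows "act \<alpha> s \<in> distinguishers G k N (\<alpha> ` X) (\<alpha> ` Y)"
proof -
  note inj = Aut_inj[OF \<alpha>]
  have "nested (act \<alpha> s) t" if "t \<in> N" for t
  proof -
    have "nested s (act (inv \<alpha>) t)"
      using s N[OF Aut_inv(1)[OF \<alpha>] that] by (simp add: distinguishers_def)
    then have "nested (act \<alpha> s) (act \<alpha> (act (inv \<alpha>) t))" using nested_act[OF inj] by blast
    then show ?thesis by (simp only: Aut_image_cancel(4)[OF \<alpha>])
  qed
  then show ?thesis
    using s separation_act[OF G \<alpha>, of s] distinguishes_sets_act[OF inj, of s X Y]
    by (simp add: distinguishers_def sep_order_act[OF inj])
qed

lemma least_crossing_act:
  assumes G: "pair_graph G" and \<alpha>: "\<alpha> \<in> Aut G" and N: "\<And>\<beta> t. \<beta> \<in> Aut G \<Longrightarrow> t \<in> N \<Longrightarrow> act \<beta> t \<in> N"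
    and s: "s \<in> least_crossing G k N"
  shows "act \<alpha> s \<in> least_crossing G k N"
proof -
  let ?L = "level_distinguishers G k N"
  note \<beta> = Aut_inv(1)[OF \<alpha>]
  note inj = Aut_inj[OF \<alpha>]
  have L: "act \<gamma> t \<in> ?L" if "\<gamma> \<in> Aut G" "t \<in> ?L" for \<gamma> t
    using that distinguishers_act[OF G that(1) N] level_pair_image[OF G that(1)]
    unfolding level_distinguishers_def by blast
  have cr: "crossing_number ?L (act \<alpha> t) = crossing_number ?L t" for t
  proof -
    have "{u \<in> ?L. crosses (act \<alpha> t) u} = act \<alpha> ` {u \<in> ?L. crosses t u}"
    proof (intro set_eqI iffI)
      fix u assume u: "u \<in> {u \<in> ?L. crosses (act \<alpha> t) u}"
      have "u = act \<alpha> (act (inv \<alpha>) u)" by (simp only: Aut_image_cancel(4)[OF \<alpha>])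
      moreover have "act (inv \<alpha>) u \<in> ?L" using u L[OF \<beta>] by simp
      moreover have "crosses t (act (inv \<alpha>) u)"
        using u nested_act[OF inj, of t "act (inv \<alpha>) u"] by (simp add: Aut_image_cancel(4)[OF \<alpha>])
      ultimately show "u \<in> act \<alpha> ` {u \<in> ?L. crosses t u}" by blast
    next
      fix u assume "u \<in> act \<alpha> ` {u \<in> ?L. crosses t u}"
      then show "u \<in> {u \<in> ?L. crosses (act \<alpha> t) u}" using L[OF \<alpha>] nested_act[OF inj] by blast
    qed
    then show ?thesis
      unfolding crossing_number_def using inj_act[OF inj] by (simp add: card_image inj_on_subset)
  qed
  obtain X Y where XY: "level_pair G k X Y" "s \<in> distinguishers G k N X Y"
    and min: "\<And>t. t \<in> distinguishers G k N X Y \<Longrightarrow> crossing_number ?L s \<le> crossing_number ?L t"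
    using s unfolding least_crossing_def by blast
  have "crossing_number ?L (act \<alpha> s) \<le> crossing_number ?L t"
    if "t \<in> distinguishers G k N (\<alpha> ` X) (\<alpha> ` Y)" for t
  proof -
    have "act (inv \<alpha>) t \<in> distinguishers G k N X Y"
      using distinguishers_act[OF G \<beta> N that] by (simp only: Aut_image_cancel(1)[OF \<alpha>])
    from min[OF this] cr[of "act (inv \<alpha>) t"] cr[of s] show ?thesis
      by (simp only: Aut_image_cancel(4)[OF \<alpha>])
  qed
  then show ?thesis
    using level_pair_image[OF G \<alpha> XY(1)] distinguishers_act[OF G \<alpha> N XY(2)]
    unfolding least_crossing_def by blast
qed

lemma nested_seps_act:
  assumes "pair_graph G" "\<alpha> \<in> Aut G" "s \<in> nested_seps G k"
  shows "act \<alpha> s \<in> nested_seps G k"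
  using assms(2,3)
proof (induction k arbitrary: \<alpha> s)
  case (Suc k)
  then show ?case
    using least_crossing_act[OF assms(1), of \<alpha> "nested_seps G k" s k] unfolding nested_seps.simps by blast
qed simp

section \<open>Orientations of a nested set of separations\<close>

text \<open>
  Orientations choose one of \<open>s\<close> and \<open>prod.swap s\<close> for each separation and point towards a common
  node of the tree; \<open>s\<close> points towards \<open>snd s\<close>. Closure under smaller separations says that
  no two chosen separations point away from each other.
\<close>

definition orientation :: "'a sep set \<Rightarrow> 'a sep set \<Rightarrow> bool" where
  "orientation N Q \<longleftrightarrow> Q \<subseteq> N \<and> (\<forall>s\<in>N. s \<in> Q \<longleftrightarrow> prod.swap s \<notin> Q) \<and>
     (\<forall>s\<in>Q. \<forall>r\<in>N. sep_le r s \<longrightarrow> r \<in> Q)"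

definition flip :: "'a sep set \<Rightarrow> 'a sep \<Rightarrow> 'a sep set" where
  "flip Q s = insert (prod.swap s) (Q - {s})"

text \<open>
  The only orientation of \<open>N\<close> that contains \<open>s\<close> and remains an orientation when \<open>s\<close> is
  flipped.
\<close>

definition tail_orientation :: "'a sep set \<Rightarrow> 'a sep \<Rightarrow> 'a sep set" where
  "tail_orientation N s = {r \<in> N. sep_le r s \<or> sep_le r (prod.swap s) \<and> r \<noteq> prod.swap s}"

definition part :: "'a pair_pre_digraph \<Rightarrow> 'a sep set \<Rightarrow> 'a set" where
  "part G Q = {v \<in> pverts G. \<forall>s\<in>Q. v \<in> snd s}"

lemma orientation_subset: "orientation N Q \<Longrightarrow> Q \<subseteq> N"
  and orientation_iff: "orientation N Q \<Longrightarrow> s \<in> N \<Longrightarrow> s \<in> Q \<longleftrightarrow> prod.swap s \<notin> Q"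
  by (simp_all add: orientation_def)

lemma orientation_down:
  assumes "orientation N Q" "s \<in> Q" "r \<in> N" "sep_le r s"
  shows "r \<in> Q"
proof -
  have "\<forall>s\<in>Q. \<forall>r\<in>N. sep_le r s \<longrightarrow> r \<in> Q"
    using assms(1) unfolding orientation_def by (elim conjE)
  then show ?thesis using assms(2-4) by blast
qed

lemma orientation_maximal:
  assumes "orientation N Q" "orientation N R" "Q \<subseteq> R"
  shows "Q = R"
proof (rule ccontr)
  assume "Q \<noteq> R"
  then obtain s where "s \<in> R" "s \<notin> Q" using assms(3) by blast
  then have "prod.swap s \<in> Q" "prod.swap s \<notin> R"
    using orientation_iff[OF assms(1)] orientation_iff[OF assms(2)] orientation_subset[OF assms(2)]
    by blast+
  then show False using assms(3) by blast
qed

lemma sep_le_refl: "sep_le s s"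
  by (simp add: sep_le_iff)

lemma sep_le_antisym: "sep_le s t \<Longrightarrow> sep_le t s \<Longrightarrow> s = t"
  unfolding sep_le_iff prod_eq_iff by blast

locale nested_separations =
  fixes G :: "'a pair_pre_digraph" and N :: "'a sep set"
  assumes graph: "pair_graph G"
    and separation: "s \<in> N \<Longrightarrow> separation G s"
    and swap_closed: "s \<in> N \<Longrightarrow> prod.swap s \<in> N"
    and nested: "s \<in> N \<Longrightarrow> t \<in> N \<Longrightarrow> nested s t"
    and proper: "s \<in> N \<Longrightarrow> \<not> sep_le s (prod.swap s)"
begin

lemma finite_N: "finite N"
proof (rule finite_subset[OF _ finite_separations[OF graph]])
  show "N \<subseteq> {s. Defs.separation G s}" using separation by blast
qed

lemma finite_orientations: "finite {Q. orientation N Q}"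
proof (rule finite_subset)
  show "{Q. orientation N Q} \<subseteq> Pow N" using orientation_subset by blast
qed (simp add: finite_N)

lemma proper': "s \<in> N \<Longrightarrow> \<not> sep_le (prod.swap s) s"
  using proper[OF swap_closed] by simp

lemma swap_neq:
  assumes "s \<in> N"
  shows "prod.swap s \<noteq> s"
proof
  assume "prod.swap s = s"
  then have "sep_le s (prod.swap s)" by (simp add: sep_le_refl)
  then show False using proper[OF assms] by blast
qed

text \<open>
  An undecided separation \<open>s\<close> can be added to a partial orientation together with all
  smaller ones: if \<open>r\<close> already belongs to it and \<open>prod.swap r\<close> is smaller than \<open>s\<close>, then
  \<open>prod.swap s\<close> is smaller than \<open>r\<close>, so \<open>s\<close> was decided.
\<close>

lemma orientation_extends:
  assumes P: "P \<subseteq> N" "\<And>s r. s \<in> P \<Longrightarrow> r \<in> N \<Longrightarrow> sep_le r s \<Longrightarrow> r \<in> P"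
    "\<And>s. s \<in> P \<Longrightarrow> prod.swap s \<notin> P"
  obtains Q where "orientation N Q" "P \<subseteq> Q"
proof -
  let ?partial = "\<lambda>P. P \<subseteq> N \<and> (\<forall>s\<in>P. \<forall>r\<in>N. sep_le r s \<longrightarrow> r \<in> P) \<and> (\<forall>s\<in>P. prod.swap s \<notin> P)"
  define S where "S = {P. ?partial P}"
  have "finite S"
    unfolding S_def by (rule finite_subset[of _ "Pow N"]) (use finite_N in auto)
  moreover have "P \<in> S" unfolding S_def using P by blast
  ultimately obtain Q where "Q \<in> S" "P \<subseteq> Q" "\<forall>R\<in>S. Q \<subseteq> R \<longrightarrow> Q = R"
    using finite_has_maximal2[of S P] by blast
  then have Q: "?partial Q" "P \<subseteq> Q" and max: "\<And>R. ?partial R \<Longrightarrow> Q \<subseteq> R \<Longrightarrow> Q = R"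
    unfolding S_def by blast+
  have "s \<in> Q \<or> prod.swap s \<in> Q" if s: "s \<in> N" for s
  proof (rule ccontr)
    assume no: "\<not> (s \<in> Q \<or> prod.swap s \<in> Q)"
    let ?R = "Q \<union> {r \<in> N. sep_le r s}"
    have "prod.swap r \<notin> ?R" if "r \<in> ?R" for r
    proof
      assume r': "prod.swap r \<in> ?R"
      have above: "prod.swap s \<in> Q" if "q \<in> Q" "sep_le (prod.swap q) s" for q
        using that Q(1) swap_closed[OF s] sep_le_swap_left by blast
      consider "r \<in> Q" "prod.swap r \<in> Q" | "r \<in> Q" "sep_le (prod.swap r) s"
        | "prod.swap r \<in> Q" "sep_le (prod.swap (prod.swap r)) s"
        | "sep_le r s" "sep_le (prod.swap r) s"
        using \<open>r \<in> ?R\<close> r' by auto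
      then show False
      proof cases
        case 1
        then show False using Q(1) by blast
      next
        case 4
        then have "sep_le (prod.swap s) s"
          using sep_le_swap_left sep_le_trans by blast
        then show False using proper'[OF s] by blast
      qed (use above no in blast)+
    qed
    moreover have "?R \<subseteq> N" "\<forall>q\<in>?R. \<forall>r\<in>N. sep_le r q \<longrightarrow> r \<in> ?R"
      using Q(1) sep_le_trans by blast+
    ultimately have "Q = ?R" using max by blast
    then show False using no s sep_le_refl[of s] by blast
  qed
  then have "orientation N Q" using Q(1) unfolding orientation_def by blast
  then show ?thesis using that Q(2) by blast
qed

text \<open>
  The separations pointing away from \<open>X\<close>, and those below \<open>Q\<close>, are forced. If
  \<open>X\<close> is contained in the part of \<open>Q\<close>, these demands are consistent.
\<close>

lemma orientation_extends_around:
  assumes N\<^sub>0: "N\<^sub>0 \<subseteq> N" "\<And>s. s \<in> N\<^sub>0 \<Longrightarrow> prod.swap s \<in> N\<^sub>0" and Q: "orientation N\<^sub>0 Q"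
    and X: "X \<subseteq> part G Q" "\<And>s. s \<in> N \<Longrightarrow> X \<subseteq> fst s \<or> X \<subseteq> snd s"
  obtains R where "orientation N R" "R \<inter> N\<^sub>0 = Q" "X \<subseteq> part G R"
proof -
  let ?P = "{s \<in> N. (\<exists>r\<in>Q. sep_le s r) \<or> \<not> X \<subseteq> fst s}"
  have QN: "Q \<subseteq> N" using orientation_subset[OF Q] N\<^sub>0(1) by blast
  have XQ: "X \<subseteq> snd r" if "r \<in> Q" for r using that X(1) by (auto simp: part_def)
  have down: "r \<in> ?P" if "s \<in> ?P" "r \<in> N" "sep_le r s" for s r
    using that sep_le_trans unfolding sep_le_iff by blast
  have cons: "prod.swap s \<notin> ?P" if s: "s \<in> ?P" for s
  proof
    assume s': "prod.swap s \<in> ?P"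
    have away: False if "r \<in> Q" "sep_le t r" "\<not> X \<subseteq> snd t" for r t
      using that XQ[OF that(1)] unfolding sep_le_iff by blast
    consider r r' where "r \<in> Q" "r' \<in> Q" "sep_le s r" "sep_le (prod.swap s) r'"
      | r where "r \<in> Q" "sep_le s r" "\<not> X \<subseteq> snd s"
      | r where "r \<in> Q" "sep_le (prod.swap s) r" "\<not> X \<subseteq> snd (prod.swap s)"
      | "\<not> X \<subseteq> fst s" "\<not> X \<subseteq> snd s"
    proof -
      have "(\<exists>r\<in>Q. sep_le s r) \<or> \<not> X \<subseteq> fst s"
        "(\<exists>r\<in>Q. sep_le (prod.swap s) r) \<or> \<not> X \<subseteq> snd s"
        using s s' by simp_all
      then show thesis using that unfolding snd_swap by blast
    qed
    then show False
    proof cases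
      case 1
      then have "sep_le (prod.swap r') r" using sep_le_swap_left sep_le_trans by blast
      moreover have "prod.swap r' \<in> N\<^sub>0" using 1(2) orientation_subset[OF Q] N\<^sub>0(2) by blast
      ultimately have "prod.swap r' \<in> Q" using orientation_down[OF Q 1(1)] by blast
      then show False using orientation_iff[OF Q] 1(2) orientation_subset[OF Q] by blast
    next
      case 4
      then show False using X(2) s by blast
    qed (use away in blast)+
  qed
  obtain R where R: "orientation N R" "?P \<subseteq> R"
    using orientation_extends[of ?P] down cons by blast
  have "Q \<subseteq> R" using R(2) QN sep_le_refl by blast
  moreover have "orientation N\<^sub>0 (R \<inter> N\<^sub>0)"
    using R(1) N\<^sub>0 unfolding orientation_def by blast
  ultimately have "R \<inter> N\<^sub>0 = Q"
    using orientation_maximal[OF Q, of "R \<inter> N\<^sub>0"] orientation_subset[OF Q] by blast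
  moreover have "X \<subseteq> snd s" if "s \<in> R" for s
  proof (rule ccontr)
    assume "\<not> X \<subseteq> snd s"
    moreover have "prod.swap s \<in> N"
      using that orientation_subset[OF R(1)] swap_closed by blast
    ultimately have "prod.swap s \<in> ?P" by simp
    then show False using R(2) that orientation_iff[OF R(1)] orientation_subset[OF R(1)] by blast
  qed
  then have "X \<subseteq> part G R" using X(1) by (auto simp: part_def)
  ultimately show ?thesis using that R(1) by blast
qed

lemma orientation_around:
  assumes "X \<subseteq> pverts G" "\<And>s. s \<in> N \<Longrightarrow> X \<subseteq> fst s \<or> X \<subseteq> snd s"
  obtains Q where "orientation N Q" "X \<subseteq> part G Q"
proof -
  have root: "orientation {} {}" and X: "X \<subseteq> part G {}"
    using assms(1) by (simp_all add: orientation_def part_def)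
  show thesis
    by (rule orientation_extends_around[of "{}" "{}" X, OF empty_subsetI _ root X assms(2)])
      (simp_all add: that)
qed

text \<open>
  The inverse of a separation below \<open>prod.swap s\<close> lies above \<open>s\<close>. By maximality it is \<open>s\<close> itself or
  not in \<open>Q\<close>, so that the flipped set remains closed under smaller separations.
\<close>

lemma orientation_flip:
  assumes Q: "orientation N Q" and s: "s \<in> Q" and max: "\<And>r. r \<in> Q \<Longrightarrow> sep_le s r \<Longrightarrow> r = s"
  shows "orientation N (flip Q s)"
proof -
  have sN: "s \<in> N" using s orientation_subset[OF Q] by blast
  have "r \<in> flip Q s" if t: "t \<in> flip Q s" and r: "r \<in> N" "sep_le r t" for r t
  proof (cases "t = prod.swap s")
    case True
    then have "sep_le s (prod.swap r)" using r(2) sep_le_swap_right by blast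
    then have "prod.swap r \<in> Q \<Longrightarrow> r = prod.swap s" using max by (metis swap_swap)
    moreover have "r \<noteq> s" using True r(2) proper[OF sN] by blast
    ultimately show ?thesis using orientation_iff[OF Q r(1)] by (auto simp: flip_def)
  next
    case False
    then have "t \<in> Q" "t \<noteq> s" using t by (auto simp: flip_def)
    then have "r \<in> Q" "r \<noteq> s" using orientation_down[OF Q _ r] max r(2) by blast+
    then show ?thesis by (simp add: flip_def)
  qed
  moreover have "r \<in> flip Q s \<longleftrightarrow> prod.swap r \<notin> flip Q s" if "r \<in> N" for r
  proof -
    have "prod.swap r = prod.swap s \<longleftrightarrow> r = s" "prod.swap r = s \<longleftrightarrow> r = prod.swap s"
      by (metis swap_swap)+
    then show ?thesis
      using orientation_iff[OF Q that] s swap_neq[OF sN] by (auto simp: flip_def)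
  qed
  moreover have "flip Q s \<subseteq> N"
    using orientation_subset[OF Q] swap_closed[OF sN] by (auto simp: flip_def)
  ultimately show ?thesis unfolding orientation_def by blast
qed

lemma flip_flip:
  assumes "orientation N Q" "s \<in> Q"
  shows "flip (flip Q s) (prod.swap s) = Q"
proof -
  have "prod.swap s \<notin> Q"
    using assms orientation_iff[OF assms(1)] orientation_subset[OF assms(1)] by blast
  then show ?thesis using assms(2) by (auto simp: flip_def)
qed

text \<open>
  The separation \<open>s\<close> is maximal in \<open>Q\<close>, for the inverse of a larger element would lie below
  \<open>prod.swap s\<close> and hence in \<open>flip Q s\<close>. As every other separation is nested with \<open>s\<close>, it or its
  inverse lies below \<open>s\<close> or below \<open>prod.swap s\<close>, which decides its orientation.
\<close>

lemma flip_determines_orientation: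
  assumes Q: "orientation N Q" and s: "s \<in> Q" and Q': "orientation N (flip Q s)"
  shows "Q = tail_orientation N s"
proof -
  have sN: "s \<in> N" using s orientation_subset[OF Q] by blast
  have s': "prod.swap s \<notin> Q" using s orientation_iff[OF Q sN] by blast
  have max: "r = s" if r: "r \<in> Q" "sep_le s r" for r
  proof (rule ccontr)
    assume "r \<noteq> s"
    have "prod.swap r \<in> N" using r orientation_subset[OF Q] swap_closed by blast
    moreover have "sep_le (prod.swap r) (prod.swap s)" using r(2) by simp
    ultimately have "prod.swap r \<in> flip Q s"
      using orientation_down[OF Q', of "prod.swap s"] by (auto simp: flip_def)
    then have "prod.swap r \<in> Q" using \<open>r \<noteq> s\<close> by (auto simp: flip_def) (metis swap_swap)
    then show False using r(1) orientation_iff[OF Q] orientation_subset[OF Q] by blast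
  qed
  show ?thesis
  proof (intro set_eqI iffI)
    fix r assume r: "r \<in> Q"
    then have rN: "r \<in> N" using orientation_subset[OF Q] by blast
    have "\<not> sep_le (prod.swap s) r" using r s' orientation_down[OF Q r swap_closed[OF sN]] by blast
    then have "sep_le r s \<or> sep_le r (prod.swap s)"
      using nested[OF rN sN] max[OF r] sep_le_refl unfolding nested_iff by blast
    then show "r \<in> tail_orientation N s" using rN r s' unfolding tail_orientation_def by blast
  next
    fix r assume "r \<in> tail_orientation N s"
    then have r: "r \<in> N" "sep_le r s \<or> sep_le r (prod.swap s) \<and> r \<noteq> prod.swap s"
      unfolding tail_orientation_def by blast+
    have "r \<in> Q" if "sep_le r (prod.swap s)" "r \<noteq> prod.swap s"
      using orientation_down[OF Q' _ r(1) that(1)] that(2) by (auto simp: flip_def)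
    then show "r \<in> Q" using r orientation_down[OF Q s r(1)] by blast
  qed
qed

lemma tail_orientation:
  assumes s: "s \<in> N"
  shows "s \<in> tail_orientation N s" "orientation N (tail_orientation N s)"
    "orientation N (flip (tail_orientation N s) s)"
proof -
  let ?Q = "tail_orientation N s"
  show sQ: "s \<in> ?Q" using s by (simp add: tail_orientation_def sep_le_refl)
  have down: "r \<in> ?Q" if "q \<in> ?Q" "r \<in> N" "sep_le r q" for q r
    using that sep_le_trans[of r q] sep_le_antisym[of q "prod.swap s"]
    unfolding tail_orientation_def by blast
  have one: "r \<in> ?Q \<longleftrightarrow> prod.swap r \<notin> ?Q" if r: "r \<in> N" for r
  proof -
    have r': "prod.swap r \<in> N" using swap_closed[OF r] .
    have "r \<in> ?Q \<or> prod.swap r \<in> ?Q"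
    proof -
      from nested[OF r s] consider "r = s" | "r = prod.swap s" | "sep_le r s"
        | "sep_le (prod.swap r) (prod.swap s)" "prod.swap r \<noteq> prod.swap s"
        | "sep_le r (prod.swap s)" "r \<noteq> prod.swap s" | "sep_le (prod.swap r) s"
        unfolding nested_iff sep_le_swap_iff using sep_le_swap_left[of r s] by (metis swap_swap)
      then show ?thesis
        by cases (use r r' sQ in \<open>simp_all add: tail_orientation_def\<close>)
    qed
    moreover have "\<not> (r \<in> ?Q \<and> prod.swap r \<in> ?Q)"
    proof
      assume "r \<in> ?Q \<and> prod.swap r \<in> ?Q"
      then consider "sep_le r s" "sep_le (prod.swap r) s"
        | "sep_le r s" "sep_le (prod.swap r) (prod.swap s)" "prod.swap r \<noteq> prod.swap s"
        | "sep_le r (prod.swap s)" "r \<noteq> prod.swap s" "sep_le (prod.swap r) s"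
        | "sep_le r (prod.swap s)" "sep_le (prod.swap r) (prod.swap s)"
        unfolding tail_orientation_def by blast
      then show False
      proof cases
        case 1
        then have "sep_le (prod.swap s) s" using sep_le_swap_left sep_le_trans by blast
        then show False using proper'[OF s] by blast
      next
        case 2
        then show False using sep_le_antisym[of r s] by simp
      next
        case 3
        then have "sep_le (prod.swap s) r" using sep_le_swap_left by blast
        then show False using 3 sep_le_antisym by blast
      next
        case 4
        then show False using sep_le_trans[of s r "prod.swap s"] proper[OF s] by simp
      qed
    qed
    ultimately show ?thesis by blast
  qed
  show Q: "orientation N ?Q"
    using one down unfolding orientation_def by (auto simp: tail_orientation_def)
  have "r = s" if "r \<in> ?Q" "sep_le s r" for r
    using that sep_le_antisym[of r s] sep_le_trans[of s r "prod.swap s"] proper[OF s]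
    unfolding tail_orientation_def by blast
  then show "orientation N (flip ?Q s)" using orientation_flip[OF Q sQ] by blast
qed

end

section \<open>The tree of orientations\<close>

lemma pawalk_verts_eq: "pcas u p v \<Longrightarrow> pawalk_verts u p = u # map snd p"
  by (induction p arbitrary: u) auto

lemma pcas_fst_in_verts: "pcas u p v \<Longrightarrow> e \<in> set p \<Longrightarrow> fst e \<in> insert u (snd ` set p)"
  by (induction p arbitrary: u) auto

lemma pcas_last_in_heads: "pcas u p v \<Longrightarrow> p \<noteq> [] \<Longrightarrow> v \<in> snd ` set p"
  by (induction p arbitrary: u) (auto, metis list.distinct(1) pcas.simps(1) list.exhaust)

lemma pcas_split:
  "pcas u p v \<Longrightarrow> w \<in> insert u (snd ` set p) \<Longrightarrow> \<exists>q r. p = q @ r \<and> pcas u q w \<and> pcas w r v"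
proof (induction p arbitrary: u)
  case (Cons e p)
  show ?case
  proof (cases "w = u")
    case True
    then show ?thesis using Cons.prems(1) by (intro exI[of _ "[]"] exI[of _ "e # p"]) simp
  next
    case False
    then have "w \<in> insert (snd e) (snd ` set p)" "pcas (snd e) p v"
      using Cons.prems by auto
    then obtain q r where "p = q @ r" "pcas (snd e) q w" "pcas w r v"
      using Cons.IH by blast
    then show ?thesis using Cons.prems(1) by (intro exI[of _ "e # q"] exI[of _ r]) simp
  qed
qed auto

lemma pcas_crossing_arc:
  "pcas u p v \<Longrightarrow> \<not> P u \<Longrightarrow> P v \<Longrightarrow> \<exists>x y. (x, y) \<in> set p \<and> \<not> P x \<and> P y"
proof (induction p arbitrary: u)
  case (Cons e p)
  show ?case
  proof (cases "P (snd e)")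
    case True
    then show ?thesis using Cons.prems by (metis list.set_intros(1) pcas.simps(2) prod.collapse)
  next
    case False
    then show ?thesis using Cons.IH[of "snd e"] Cons.prems by auto
  qed
qed auto

lemma connected_induced_if_reachable:
  assumes T: "pair_graph T" and M: "M \<subseteq> pverts T" "M \<noteq> {}"
    and reach: "\<And>t u. t \<in> M \<Longrightarrow> u \<in> M \<Longrightarrow> (t, u) \<in> rtrancl_on M (parcs T)"
  shows "Digraph_Component.connected (with_proj T \<restriction> M)"
proof -
  interpret pair_graph T by fact
  let ?S = "mk_symmetric (with_proj T \<restriction> M)"
  have S: "pverts ?S = M" "parcs ?S = {(u, v) \<in> parcs T. u \<in> M \<and> v \<in> M}"
    by (auto simp: mk_symmetric_def induce_subgraph_def with_proj_def arcs_symmetric)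
  have "reachable (with_proj ?S) t u" if "t \<in> M" "u \<in> M" for t u
    using reach[OF that] that(1) unfolding reachable_def with_proj_simps
  proof (induction rule: rtrancl_on_induct)
    case base
    then show ?case using S by simp
  next
    case (step y z)
    then show ?case using S by (auto intro: rtrancl_on_into_rtrancl_on)
  qed
  then show ?thesis
    using M S by (simp add: Digraph_Component.connected_def strongly_connected_def)
qed

text \<open>
  A tree whose nodes are labelled bijectively by the orientations of \<open>N\<close>, two nodes being
  adjacent if their orientations differ in a single separation.
\<close>

locale orientation_tree = nested_separations G N
  for G :: "'a pair_pre_digraph" and N :: "'a sep set" +
  fixes T :: "'t pair_pre_digraph" and orient :: "'t \<Rightarrow> 'a sep set"
  assumes bij: "bij_betw orient (pverts T) {Q. orientation N Q}"
    and arcs: "parcs T = {(t, u). t \<in> pverts T \<and> u \<in> pverts T \<and>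
      (\<exists>s\<in>orient t. orient u = flip (orient t) s)}"
begin

lemma orient: "t \<in> pverts T \<Longrightarrow> orientation N (orient t)"
  using bij by (auto simp: bij_betw_def)

lemma orient_inj: "t \<in> pverts T \<Longrightarrow> u \<in> pverts T \<Longrightarrow> orient t = orient u \<Longrightarrow> t = u"
  using bij by (auto simp: bij_betw_def inj_on_def)

lemma orient_surj:
  assumes "orientation N Q"
  obtains t where "t \<in> pverts T" "orient t = Q"
proof -
  have "Q \<in> orient ` pverts T" using assms bij by (simp add: bij_betw_def)
  then show ?thesis using that by blast
qed

lemma pair_graph_tree: "pair_graph T"
proof
  show "finite (pverts T)" using finite_orientations bij_betw_finite[OF bij] by simp
  then have "finite (pverts T \<times> pverts T)" by simp
  moreover have "parcs T \<subseteq> pverts T \<times> pverts T" unfolding arcs by blast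
  ultimately show "finite (parcs T)" by (rule finite_subset[rotated])
  fix e assume "e \<in> parcs T"
  then obtain t u s where e: "e = (t, u)" "t \<in> pverts T" "u \<in> pverts T" "s \<in> orient t"
    "orient u = flip (orient t) s"
    unfolding arcs by blast
  then show "fst e \<in> pverts T" "snd e \<in> pverts T" by auto
  have "s \<in> N" using e(2,4) orient orientation_subset by blast
  then have "prod.swap s \<noteq> s" by (rule swap_neq)
  then have "s \<notin> flip (orient t) s" unfolding flip_def by force
  then show "fst e \<noteq> snd e" using e by auto
next
  have "(u, t) \<in> parcs T" if tu: "(t, u) \<in> parcs T" for t u
  proof -
    obtain s where s: "t \<in> pverts T" "u \<in> pverts T" "s \<in> orient t" "orient u = flip (orient t) s"
      using tu unfolding arcs by blast
    moreover have "prod.swap s \<in> orient u" using s(4) by (simp add: flip_def)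
    moreover have "orient t = flip (orient u) (prod.swap s)"
      using flip_flip[OF orient[OF s(1)] s(3)] s(4) by simp
    ultimately show ?thesis unfolding arcs by blast
  qed
  then show "symmetric (with_proj T)" unfolding symmetric_def by (auto intro: symI)
qed

text \<open>
  Walking from one orientation to another, flip a maximal separation on which they differ. The
  separations on which both ends agree are never flipped.
\<close>

lemma reachable_within:
  assumes "t \<in> pverts T" "u \<in> pverts T" "orient t \<inter> K = orient u \<inter> K"
  shows "(t, u) \<in> rtrancl_on {w \<in> pverts T. orient w \<inter> K = orient u \<inter> K} (parcs T)"
  using assms(1,3)
proof (induction "card (orient t - orient u)" arbitrary: t rule: less_induct)
  case less
  let ?M = "{w \<in> pverts T. orient w \<inter> K = orient u \<inter> K}"
  let ?D = "orient t - orient u"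
  have ot: "orientation N (orient t)" and ou: "orientation N (orient u)"
    using less.prems assms(2) orient by auto
  have fin: "finite ?D" using orientation_subset[OF ot] finite_N finite_subset by blast
  show ?case
  proof (cases "?D = {}")
    case True
    then have "t = u"
      using orientation_maximal[OF ot ou] orient_inj less.prems assms(2) by blast
    then show ?thesis using less.prems by simp
  next
    case False
    have "asymp_on ?D (\<lambda>r s. sep_le r s \<and> r \<noteq> s)" "transp_on ?D (\<lambda>r s. sep_le r s \<and> r \<noteq> s)"
      using sep_le_antisym sep_le_trans unfolding asymp_on_def transp_on_def by blast+
    then obtain s where s: "s \<in> ?D" and max: "\<And>r. r \<in> ?D \<Longrightarrow> sep_le s r \<Longrightarrow> r = s"
      using Finite_Set.bex_max_element[OF fin _ _ False, of "\<lambda>r s. sep_le r s \<and> r \<noteq> s"] by metis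
    have sN: "s \<in> N" using s orientation_subset[OF ot] by blast
    have "r = s" if "r \<in> orient t" "sep_le s r" for r
      using that max orientation_down[OF ou _ sN] s by blast
    then have fl: "orientation N (flip (orient t) s)"
      using orientation_flip[OF ot] s by blast
    obtain t' where t': "t' \<in> pverts T" "orient t' = flip (orient t) s"
      using orient_surj[OF fl] .
    have arc: "(t, t') \<in> parcs T" unfolding arcs using less.prems t' s by blast
    have swap: "prod.swap s \<in> orient u" using s sN orientation_iff[OF ou] by blast
    have "orient t' - orient u = ?D - {s}" using swap t'(2) by (auto simp: flip_def)
    then have "card (orient t' - orient u) < card ?D"
      using s fin by (metis card_Diff1_less)
    moreover have "s \<notin> K" using s less.prems(2) by blast
    moreover have "prod.swap s \<notin> K"
      using swap less.prems(2) s sN orientation_iff[OF ot] by blast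
    then have "orient t' \<inter> K = orient u \<inter> K"
      using less.prems(2) \<open>s \<notin> K\<close> t'(2) by (auto simp: flip_def)
    ultimately have "(t', u) \<in> rtrancl_on ?M (parcs T)" using less.hyps t'(1) by blast
    then show ?thesis
      using arc less.prems by (auto intro: converse_rtrancl_on_into_rtrancl_on)
  qed
qed

lemma connected_within:
  assumes "t \<in> pverts T" "orient t \<inter> K = Q"
  shows "Digraph_Component.connected (with_proj T \<restriction> {w \<in> pverts T. orient w \<inter> K = Q})"
proof (rule connected_induced_if_reachable[OF pair_graph_tree])
  fix v u assume v: "v \<in> {w \<in> pverts T. orient w \<inter> K = Q}" and u: "u \<in> {w \<in> pverts T. orient w \<inter> K = Q}"
  then show "(v, u) \<in> rtrancl_on {w \<in> pverts T. orient w \<inter> K = Q} (parcs T)"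
    using reachable_within[of v u K] by simp
qed (use assms in auto)

text \<open>Each separation is flipped along exactly one arc.\<close>

lemma arc_unique:
  assumes "(t, u) \<in> parcs T" "s \<in> orient t" "s \<notin> orient u"
    and "(t', u') \<in> parcs T" "s \<in> orient t'" "s \<notin> orient u'"
  shows "t = t'" "u = u'"
proof -
  have "orient t = tail_orientation N s \<and> orient u = flip (orient t) s \<and> t \<in> pverts T \<and> u \<in> pverts T"
    if tu: "(t, u) \<in> parcs T" "s \<in> orient t" "s \<notin> orient u" for t u
  proof -
    obtain r where r: "t \<in> pverts T" "u \<in> pverts T" "r \<in> orient t" "orient u = flip (orient t) r"
      using tu(1) unfolding arcs by blast
    then have "r = s" using tu(2,3) by (auto simp: flip_def)
    then show ?thesis
      using r flip_determines_orientation[OF orient[OF r(1)] r(3)] orient[OF r(2)] by simp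
  qed
  from this[OF assms(1-3)] this[OF assms(4-6)] show "t = t'" "u = u'"
    using orient_inj by metis+
qed

lemma arc_separation:
  assumes "(t, u) \<in> parcs T"
  obtains s where "s \<in> N" "s \<in> orient t" "s \<notin> orient u" "prod.swap s \<in> orient u"
    "prod.swap s \<notin> orient t"
proof -
  obtain s where s: "t \<in> pverts T" "u \<in> pverts T" "s \<in> orient t" "orient u = flip (orient t) s"
    using assms unfolding arcs by blast
  have sN: "s \<in> N" using s orient orientation_subset by blast
  have "s \<notin> orient u" "prod.swap s \<in> orient u" using s swap_neq[OF sN] by (auto simp: flip_def)
  moreover have "prod.swap s \<notin> orient t" using s orientation_iff[OF orient sN] by blast
  ultimately show ?thesis using that sN s(3) by blast
qed

lemma arc_reverse_unique:
  assumes "(t, u) \<in> parcs T" "s \<in> orient t" "s \<notin> orient u"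
    and "(u', t') \<in> parcs T" "s \<in> orient t'" "s \<notin> orient u'"
  shows "t = t'" "u = u'"
proof -
  interpret pair_graph T by (rule pair_graph_tree)
  show "t = t'" "u = u'"
    using arc_unique[OF assms(1-3) arcs_symmetric[OF assms(4)] assms(5,6)] by blast+
qed

text \<open>
  A closed walk flips the separation of its first arc back later on, and must use the reverse of
  this arc to do so. In a cycle, the reverse arc can only come second and last.
\<close>

lemma acyclic:
  assumes "pre_digraph.cycle (with_proj T) p"
  shows "length p < 3"
proof -
  interpret pair_graph T by (rule pair_graph_tree)
  obtain w where p: "awalk w p w" "distinct (tl (pawalk_verts w p))" "p \<noteq> []"
    using assms unfolding cycle_def by blast
  obtain e es where es: "p = e # es" using p(3) by (cases p) auto
  obtain t u where e: "e = (t, u)" by fastforce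
  have walk: "(t, u) \<in> parcs T" "set es \<subseteq> parcs T" "pcas u es t" "w = t"
    using p(1) unfolding awalk_def es e by auto
  have dist: "distinct (u # map snd es)"
    using p(2) pawalk_verts_eq[OF walk(3)] by (simp add: es e)
  obtain s where s: "s \<in> orient t" "s \<notin> orient u" using arc_separation[OF walk(1)] .
  obtain x y where xy: "(x, y) \<in> set es" "s \<notin> orient x" "s \<in> orient y"
    using pcas_crossing_arc[OF walk(3), of "\<lambda>x. s \<in> orient x"] s by blast
  have "t = y" "u = x"
    using arc_reverse_unique[OF walk(1) s, of x y] xy walk(2) by blast+
  then have reverse: "(u, t) \<in> set es" using xy(1) by simp
  then obtain e' rest where es_eq: "es = e' # rest" by (cases es) auto
  have e': "fst e' = u" "pcas (snd e') rest t" using walk(3) by (simp_all add: es_eq)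
  have "(u, t) \<notin> set rest"
  proof
    assume "(u, t) \<in> set rest"
    from pcas_fst_in_verts[OF e'(2) this] dist show False by (auto simp: es_eq)
  qed
  then have "snd e' = t" using reverse by (auto simp: es_eq)
  moreover have "rest = []"
  proof (rule ccontr)
    assume "rest \<noteq> []"
    then show False using pcas_last_in_heads[OF e'(2)] dist \<open>snd e' = t\<close> by (auto simp: es_eq)
  qed
  ultimately show ?thesis by (simp add: es es_eq)
qed

lemma exists_node: "\<exists>t. t \<in> pverts T"
proof -
  obtain Q where "orientation N Q" using orientation_around[of "{}"] by blast
  then show ?thesis using orient_surj by blast
qed

lemma undirected_tree: "undirected_tree T"
proof -
  interpret pair_graph T by (rule pair_graph_tree)
  obtain t where t: "t \<in> pverts T" using exists_node by blast
  have "with_proj T \<restriction> pverts T = with_proj T"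
    unfolding induce_subgraph_def with_proj_def using in_arcsD1 in_arcsD2 by auto
  then have "Digraph_Component.connected (with_proj T)"
    using connected_within[of t "{}" "{}"] t by simp
  then show ?thesis
    unfolding undirected_tree_def using pair_graph_tree acyclic by (meson not_less)
qed

text \<open>
  If the ends of a path orient a separation alike, so does every node of the path: otherwise the path
  would traverse the arc of the separation in both directions.
\<close>

lemma orient_on_path:
  assumes path: "on_path T t\<^sub>1 t\<^sub>2 t\<^sub>3" and s: "s \<in> orient t\<^sub>2"
  shows "s \<in> orient t\<^sub>1 \<or> s \<in> orient t\<^sub>3"
proof (rule ccontr)
  interpret pair_graph T by (rule pair_graph_tree)
  assume no: "\<not> (s \<in> orient t\<^sub>1 \<or> s \<in> orient t\<^sub>3)"
  obtain p where p: "apath t\<^sub>1 p t\<^sub>3" "t\<^sub>2 \<in> set (pawalk_verts t\<^sub>1 p)"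
    using path unfolding on_path_def by blast
  then have walk: "set p \<subseteq> parcs T" "pcas t\<^sub>1 p t\<^sub>3" "distinct (pawalk_verts t\<^sub>1 p)"
    unfolding apath_def awalk_def by auto
  then have dist: "distinct (t\<^sub>1 # map snd p)" and "t\<^sub>2 \<in> insert t\<^sub>1 (snd ` set p)"
    using p(2) pawalk_verts_eq[OF walk(2)] by auto
  then obtain q r where qr: "p = q @ r" "pcas t\<^sub>1 q t\<^sub>2" "pcas t\<^sub>2 r t\<^sub>3"
    using pcas_split[OF walk(2)] by blast
  obtain x y where xy: "(x, y) \<in> set q" "s \<notin> orient x" "s \<in> orient y"
    using pcas_crossing_arc[OF qr(2), of "\<lambda>x. s \<in> orient x"] s no by blast
  obtain x' y' where xy': "(x', y') \<in> set r" "s \<in> orient x'" "s \<notin> orient y'"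
    using pcas_crossing_arc[OF qr(3), of "\<lambda>x. s \<notin> orient x"] s no by blast
  have "(x', y') \<in> parcs T" "(x, y) \<in> parcs T" using xy xy' walk(1) qr(1) by auto
  then have "y' = x" using arc_reverse_unique(2)[of x' y' s x y] xy xy' by blast
  moreover have "x \<in> insert t\<^sub>1 (snd ` set q)" using pcas_fst_in_verts[OF qr(2) xy(1)] by simp
  moreover have "y' \<in> snd ` set r" using xy'(1) by force
  ultimately show False using dist by (auto simp: qr(1))
qed

lemma tree_decomposition: "tree_decomposition G T (part G \<circ> orient)"
proof -
  interpret G: pair_graph G by (rule graph)
  have around: "\<exists>t\<in>pverts T. X \<subseteq> part G (orient t)"
    if X: "X \<subseteq> pverts G" "\<And>s. s \<in> N \<Longrightarrow> X \<subseteq> fst s \<or> X \<subseteq> snd s" for X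
  proof -
    obtain Q where Q: "orientation N Q" "X \<subseteq> part G Q"
      using orientation_around[OF X] .
    obtain t where "t \<in> pverts T" "orient t = Q" using orient_surj[OF Q(1)] .
    then show ?thesis using Q(2) by blast
  qed
  have "\<exists>t\<in>pverts T. v \<in> part G (orient t)" if v: "v \<in> pverts G" for v
    using around[of "{v}"] v separation_Un[OF graph separation] by auto
  then have "(\<Union>t\<in>pverts T. part G (orient t)) = pverts G"
    by (auto simp: part_def)
  moreover have "\<exists>t\<in>pverts T. u \<in> part G (orient t) \<and> v \<in> part G (orient t)"
    if uv: "(u, v) \<in> parcs G" for u v
  proof -
    have "{u, v} \<subseteq> fst s \<or> {u, v} \<subseteq> snd s" if s: "s \<in> N" for s
      using separation[OF s] separation_iff[OF graph, of "fst s" "snd s"] uv by auto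
    moreover have "{u, v} \<subseteq> pverts G" using G.in_arcsD1[OF uv] G.in_arcsD2[OF uv] by blast
    ultimately show ?thesis using around[of "{u, v}"] by auto
  qed
  moreover have "part G (orient t\<^sub>1) \<inter> part G (orient t\<^sub>3) \<subseteq> part G (orient t\<^sub>2)"
    if "on_path T t\<^sub>1 t\<^sub>2 t\<^sub>3" for t\<^sub>1 t\<^sub>2 t\<^sub>3
    using orient_on_path[OF that] unfolding part_def by blast
  ultimately show ?thesis
    unfolding tree_decomposition_def using undirected_tree by auto
qed

lemma adhesion_le:
  assumes "\<And>s. s \<in> N \<Longrightarrow> sep_order s \<le> k"
  shows "adhesion T (part G \<circ> orient) \<le> k"
proof -
  interpret pair_graph T by (rule pair_graph_tree)
  interpret G: pair_graph G by (rule graph)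
  have "card (part G (orient t) \<inter> part G (orient u)) \<le> k" if arc: "(t, u) \<in> parcs T" for t u
  proof -
    obtain s where s: "s \<in> N" "s \<in> orient t" "prod.swap s \<in> orient u"
      using arc_separation[OF arc] by blast
    have sub: "part G (orient t) \<inter> part G (orient u) \<subseteq> fst s \<inter> snd s"
      using s(2,3) by (auto simp: part_def)
    have "fst s \<inter> snd s \<subseteq> pverts G" using separation_Un[OF graph separation[OF s(1)]] by blast
    then have "card (part G (orient t) \<inter> part G (orient u)) \<le> card (fst s \<inter> snd s)"
      using sub G.pair_finite_verts finite_subset by (intro card_mono) blast+
    then show ?thesis using assms[OF s(1)] by (simp add: sep_order_eq)
  qed
  then show ?thesis
    unfolding adhesion_def using pair_finite_arcs by auto
qed

text \<open>
  A node whose part contains \<open>X\<close> orients \<open>s\<close> towards \<open>fst s\<close>, as \<open>X\<close> is too large for the separator.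
\<close>

lemma distinguishes:
  assumes X: "inseparable G k X" and Y: "inseparable G k Y" and s: "s \<in> N" "distinguishes_sets s X Y"
    and ord: "\<And>s. s \<in> N \<Longrightarrow> sep_order s \<le> k"
  shows "distinguishes T (part G \<circ> orient) X Y"
proof -
  have node: "\<exists>t\<in>pverts T. Z \<subseteq> part G (orient t)" if Z: "inseparable G k Z" for Z
  proof -
    have "Z \<subseteq> fst s \<or> Z \<subseteq> snd s" if "s \<in> N" for s
      using inseparable_subset_side[OF graph Z separation ord] that by blast
    moreover have "Z \<subseteq> pverts G" using Z by (simp add: inseparable_def)
    ultimately obtain Q where Q: "orientation N Q" "Z \<subseteq> part G Q"
      using orientation_around[of Z] by metis
    obtain t where "t \<in> pverts T" "orient t = Q" using orient_surj[OF Q(1)] .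
    then show ?thesis using Q(2) by blast
  qed
  obtain t u where t: "t \<in> pverts T" "X \<subseteq> part G (orient t)"
    and u: "u \<in> pverts T" "Y \<subseteq> part G (orient u)"
    using node[OF X] node[OF Y] by blast
  have XY: "X \<subseteq> fst s" "Y \<subseteq> snd s" using s(2) by (auto simp: distinguishes_sets_def)
  have "\<not> X \<subseteq> snd s" "\<not> Y \<subseteq> fst s"
    using inseparable_not_both_sides[OF graph X separation[OF s(1)] ord[OF s(1)]]
      inseparable_not_both_sides[OF graph Y separation[OF s(1)] ord[OF s(1)]] XY by blast+
  then have "s \<notin> orient t" using t(2) by (auto simp: part_def)
  then have "prod.swap s \<in> orient t" using orientation_iff[OF orient[OF t(1)] s(1)] by blast
  then have "part G (orient t) \<subseteq> fst s" by (auto simp: part_def)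
  then have "part G (orient t) \<noteq> part G (orient u)" using u(2) \<open>\<not> Y \<subseteq> fst s\<close> by blast
  then show ?thesis unfolding distinguishes_def comp_def using t u by blast
qed

end

section \<open>Refinement\<close>

text \<open>
  Restricting orientations from \<open>N'\<close> to \<open>N\<close> maps the tree of \<open>N'\<close> to the tree of \<open>N\<close> and
  contracts the arcs that flip separations outside \<open>N\<close>.
\<close>

lemma td_le_if_subset:
  assumes T: "orientation_tree G N T ori" and T': "orientation_tree G N' T' ori'" and sub: "N \<subseteq> N'"
  shows "td_le T (part G \<circ> ori) T' (part G \<circ> ori')"
proof -
  interpret T: orientation_tree G N T ori by fact
  interpret T': orientation_tree G N' T' ori' by fact
  let ?M = "\<lambda>t. {w \<in> pverts T'. ori' w \<inter> N = ori t}"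
  have extend: "\<exists>w\<in>?M t. X \<subseteq> part G (ori' w)"
    if t: "t \<in> pverts T" and X: "X \<subseteq> part G (ori t)" "\<And>s. s \<in> N' \<Longrightarrow> X \<subseteq> fst s \<or> X \<subseteq> snd s" for t X
  proof -
    obtain R where R: "orientation N' R" "R \<inter> N = ori t" "X \<subseteq> part G R"
      using T'.orientation_extends_around[OF sub T.swap_closed T.orient[OF t] X] .
    obtain w where "w \<in> pverts T'" "ori' w = R" using T'.orient_surj[OF R(1)] .
    then show ?thesis using R by blast
  qed
  have "Digraph_Component.connected (with_proj T' \<restriction> ?M t)" if t: "t \<in> pverts T" for t
  proof -
    obtain w where "w \<in> ?M t" using extend[OF t, of "{}"] by blast
    then show ?thesis using T'.connected_within[of w N "ori t"] by blast
  qed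
  moreover have "?M t \<inter> ?M u = {}" if "t \<in> pverts T" "u \<in> pverts T" "t \<noteq> u" for t u
    using T.orient_inj[of t u] that by auto
  moreover have "\<exists>w\<in>?M t. \<exists>w'\<in>?M u. (w, w') \<in> parcs T'" if tu: "(t, u) \<in> parcs T" for t u
  proof -
    obtain s where s: "t \<in> pverts T" "u \<in> pverts T" "s \<in> ori t" "ori u = flip (ori t) s"
      using tu unfolding T.arcs by blast
    have sN: "s \<in> N" using s T.orient orientation_subset by blast
    then have sN': "s \<in> N'" using sub by blast
    have "ori t = tail_orientation N s"
      using T.flip_determines_orientation[OF T.orient[OF s(1)] s(3)] T.orient[OF s(2)] s(4) by simp
    then have t: "tail_orientation N' s \<inter> N = ori t"
      using sub by (auto simp: tail_orientation_def)
    then have u: "flip (tail_orientation N' s) s \<inter> N = ori u"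
      using s(4) T.swap_closed[OF sN] by (auto simp: flip_def)
    obtain w where w: "w \<in> pverts T'" "ori' w = tail_orientation N' s"
      using T'.orient_surj[OF T'.tail_orientation(2)[OF sN']] .
    obtain w' where w': "w' \<in> pverts T'" "ori' w' = flip (tail_orientation N' s) s"
      using T'.orient_surj[OF T'.tail_orientation(3)[OF sN']] .
    have "(w, w') \<in> parcs T'"
      unfolding T'.arcs using w w' T'.tail_orientation(1)[OF sN'] by auto
    moreover have "w \<in> ?M t" "w' \<in> ?M u" using w w' t u by simp_all
    ultimately show ?thesis by blast
  qed
  moreover have "part G (ori t) = (\<Union>w\<in>?M t. part G (ori' w))" if t: "t \<in> pverts T" for t
  proof
    show "part G (ori t) \<subseteq> (\<Union>w\<in>?M t. part G (ori' w))"
    proof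
      fix v assume v: "v \<in> part G (ori t)"
      have "{v} \<subseteq> fst s \<or> {v} \<subseteq> snd s" if "s \<in> N'" for s
        using v separation_Un[OF T'.graph T'.separation[OF that]] by (auto simp: part_def)
      then show "v \<in> (\<Union>w\<in>?M t. part G (ori' w))" using extend[OF t, of "{v}"] v by auto
    qed
    show "(\<Union>w\<in>?M t. part G (ori' w)) \<subseteq> part G (ori t)"
      by (auto simp: part_def)
  qed
  ultimately show ?thesis
    unfolding td_le_def minor_model_def by (intro exI[of _ ?M]) auto
qed

section \<open>The action on the tree\<close>

lemma part_act:
  assumes "\<alpha> \<in> Aut G"
  shows "part G (act \<alpha> ` Q) = \<alpha> ` part G Q"
proof -
  note inj = Aut_inj[OF assms]
  have "\<alpha> v \<in> pverts G \<longleftrightarrow> v \<in> pverts G" for v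
    using inj_image_mem_iff[OF inj, of v "pverts G"] Aut_image_pverts[OF assms] by simp
  then have mem: "\<alpha> v \<in> part G (act \<alpha> ` Q) \<longleftrightarrow> v \<in> part G Q" for v
    by (simp add: part_def inj_image_mem_iff[OF inj])
  have "x \<in> part G (act \<alpha> ` Q) \<longleftrightarrow> x \<in> \<alpha> ` part G Q" for x
  proof -
    have "\<alpha> permutes pverts G" using assms by (simp add: Aut_def)
    then have "surj \<alpha>" by (rule permutes_surj)
    then obtain v where "x = \<alpha> v" by blast
    then show ?thesis using mem[of v] by (simp add: inj_image_mem_iff[OF inj])
  qed
  then show ?thesis by blast
qed

lemma flip_act: "inj \<alpha> \<Longrightarrow> act \<alpha> ` flip Q s = flip (act \<alpha> ` Q) (act \<alpha> s)"
  using inj_act[of \<alpha>] by (simp add: flip_def act_swap image_set_diff)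

lemma orientation_act:
  assumes \<alpha>: "\<alpha> \<in> Aut G" and N: "\<And>\<beta> s. \<beta> \<in> Aut G \<Longrightarrow> s \<in> N \<Longrightarrow> act \<beta> s \<in> N"
    and Q: "orientation N Q"
  shows "orientation N (act \<alpha> ` Q)"
proof -
  have inj: "inj \<alpha>" "inj (act \<alpha>)" using Aut_inj[OF \<alpha>] inj_act by auto
  have pre: "\<exists>r\<in>N. s = act \<alpha> r" if "s \<in> N" for s
    using N[OF Aut_inv(1)[OF \<alpha>] that] Aut_image_cancel(4)[OF \<alpha>, of s] by metis
  have mem: "act \<alpha> s \<in> act \<alpha> ` Q \<longleftrightarrow> s \<in> Q" for s using inj_image_mem_iff[OF inj(2)] .
  have "s \<in> act \<alpha> ` Q \<longleftrightarrow> prod.swap s \<notin> act \<alpha> ` Q" if s: "s \<in> N" for s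
  proof -
    obtain r where r: "r \<in> N" "s = act \<alpha> r" using pre[OF s] by blast
    have "s \<in> act \<alpha> ` Q \<longleftrightarrow> r \<in> Q" "prod.swap s \<in> act \<alpha> ` Q \<longleftrightarrow> prod.swap r \<in> Q"
      using mem[of r] mem[of "prod.swap r"] by (simp_all only: r(2) act_swap)
    then show ?thesis using orientation_iff[OF Q r(1)] by blast
  qed
  moreover have "r \<in> act \<alpha> ` Q" if s: "s \<in> act \<alpha> ` Q" "r \<in> N" "sep_le r s" for r s
  proof -
    obtain q where q: "q \<in> Q" "s = act \<alpha> q" using s(1) by blast
    obtain p where p: "p \<in> N" "r = act \<alpha> p" using pre[OF s(2)] by blast
    have "sep_le p q" using s(3) sep_le_act[OF inj(1)] p q by blast
    then show ?thesis using orientation_down[OF Q q(1) p(1)] p(2) by blast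
  qed
  moreover have "act \<alpha> ` Q \<subseteq> N" using N[OF \<alpha>] orientation_subset[OF Q] by blast
  ultimately show ?thesis unfolding orientation_def by blast
qed

context orientation_tree
begin

lemma Aut_invariant:
  assumes N: "\<And>\<alpha> s. \<alpha> \<in> Aut G \<Longrightarrow> s \<in> N \<Longrightarrow> act \<alpha> s \<in> N"
  shows "Aut_invariant G T (part G \<circ> orient)"
proof -
  define \<phi> where "\<phi> \<alpha> t =
    (if t \<in> pverts T then inv_into (pverts T) orient (act \<alpha> ` orient t) else t)" for \<alpha> t
  have \<phi>: "\<phi> \<alpha> t \<in> pverts T" "orient (\<phi> \<alpha> t) = act \<alpha> ` orient t"
    if \<alpha>: "\<alpha> \<in> Aut G" and t: "t \<in> pverts T" for \<alpha> t
  proof -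
    have "act \<alpha> ` orient t \<in> orient ` pverts T"
      using orientation_act[OF \<alpha> N orient[OF t]] bij by (auto simp: bij_betw_def)
    then show "\<phi> \<alpha> t \<in> pverts T" "orient (\<phi> \<alpha> t) = act \<alpha> ` orient t"
      using t by (simp_all add: \<phi>_def inv_into_into f_inv_into_f)
  qed
  have \<phi>_id: "\<phi> id t = t" if "t \<in> pverts T" for t
  proof -
    have "act id ` orient t = orient t" by (simp add: act_id)
    then show ?thesis using that bij by (simp add: \<phi>_def bij_betw_def)
  qed
  have \<phi>_comp: "\<phi> (\<beta> \<circ> \<alpha>) t = \<phi> \<beta> (\<phi> \<alpha> t)" if "\<alpha> \<in> Aut G" "\<beta> \<in> Aut G" "t \<in> pverts T" for \<alpha> \<beta> t
    using \<phi>(2)[OF that(1,3)] that(3) \<phi>(1)[OF that(1,3)] by (simp add: \<phi>_def image_image act_comp)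
  have arc: "(\<phi> \<alpha> t, \<phi> \<alpha> u) \<in> parcs T" if \<alpha>: "\<alpha> \<in> Aut G" and tu: "(t, u) \<in> parcs T" for \<alpha> t u
  proof -
    obtain s where s: "t \<in> pverts T" "u \<in> pverts T" "s \<in> orient t" "orient u = flip (orient t) s"
      using tu unfolding arcs by blast
    then have "orient (\<phi> \<alpha> u) = flip (orient (\<phi> \<alpha> t)) (act \<alpha> s)" "act \<alpha> s \<in> orient (\<phi> \<alpha> t)"
      using \<phi>(2)[OF \<alpha>] flip_act[OF Aut_inj[OF \<alpha>]] by auto
    then show ?thesis unfolding arcs using \<phi>(1)[OF \<alpha>] s by blast
  qed
  have cancel: "\<phi> (inv \<alpha>) (\<phi> \<alpha> t) = t" "\<phi> \<alpha> (\<phi> (inv \<alpha>) t) = t" if "\<alpha> \<in> Aut G" "t \<in> pverts T" for \<alpha> t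
    using \<phi>_comp[OF that(1) Aut_inv(1)[OF that(1)] that(2)]
      \<phi>_comp[OF Aut_inv(1)[OF that(1)] that(1,2)] Aut_inv(2,3)[OF that(1)] \<phi>_id[OF that(2)] by simp_all
  have "\<phi> \<alpha> \<in> Aut T" if \<alpha>: "\<alpha> \<in> Aut G" for \<alpha>
  proof -
    have "bij_betw (\<phi> \<alpha>) (pverts T) (pverts T)"
      using \<phi>(1)[OF \<alpha>] \<phi>(1)[OF Aut_inv(1)[OF \<alpha>]] cancel[OF \<alpha>]
      by (intro bij_betw_byWitness[where f' = "\<phi> (inv \<alpha>)"]) auto
    then have "\<phi> \<alpha> permutes pverts T"
      by (rule bij_imp_permutes) (simp add: \<phi>_def)
    moreover have "(t, u) \<in> parcs T" if "t \<in> pverts T" "u \<in> pverts T" "(\<phi> \<alpha> t, \<phi> \<alpha> u) \<in> parcs T" for t u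
      using arc[OF Aut_inv(1)[OF \<alpha>] that(3)] cancel(1)[OF \<alpha>] that by simp
    ultimately show ?thesis using arc[OF \<alpha>] by (auto simp: Aut_def)
  qed
  moreover have "part G (orient (\<phi> \<alpha> t)) = \<alpha> ` part G (orient t)" if "\<alpha> \<in> Aut G" "t \<in> pverts T" for \<alpha> t
    using \<phi>(2)[OF that] part_act[OF that(1)] by simp
  ultimately show ?thesis
    unfolding Aut_invariant_def using \<phi>_id \<phi>_comp by (intro exI[of _ \<phi>]) simp
qed

end

section \<open>The sequence of tree-decompositions\<close>

text \<open>
  There are finitely many orientations, so that natural numbers can serve as nodes.
\<close>

lemma (in nested_separations) orientation_tree_exists:
  "\<exists>(T :: nat pair_pre_digraph) ori. orientation_tree G N T ori"
proof -
  let ?O = "{Q. orientation N Q}"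
  from finite_imp_inj_to_nat_seg[OF finite_orientations]
  obtain n and f :: "'a sep set \<Rightarrow> nat" where f: "inj_on f ?O"
    by (elim exE conjE)
  define ori where "ori = inv_into ?O f"
  define T where "T = \<lparr>pverts = f ` ?O, parcs = {(t, u). t \<in> f ` ?O \<and> u \<in> f ` ?O \<and>
      (\<exists>s\<in>ori t. ori u = flip (ori t) s)}\<rparr>"
  have "orientation_tree G N T ori"
    by (intro orientation_tree.intro orientation_tree_axioms.intro nested_separations_axioms)
      (simp_all add: T_def ori_def bij_betw_inv_into[OF inj_on_imp_bij_betw[OF f]])
  then show ?thesis by blast
qed

text \<open>
  A selected separation is proper because each of its sides contains a block that is too large for
  the separator.
\<close>

lemma nested_separations_nested_seps:
  assumes G: "pair_graph G"
  shows "nested_separations G (nested_seps G k)"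
proof (rule nested_separations.intro)
  show "pair_graph G" by fact
  fix s assume s: "s \<in> nested_seps G k"
  obtain l X Y where lXY: "level_pair G l X Y" "separation G s" "sep_order s = l"
    "distinguishes_sets s X Y"
    using nested_sepsD[OF s] by blast
  show "separation G s" by fact
  show "prod.swap s \<in> nested_seps G k" using nested_seps_swap[OF G s] .
  have "inseparable G l X" using lXY(1) by (simp add: level_pair_def robust_block_def block_def)
  then have "\<not> (X \<subseteq> fst s \<and> X \<subseteq> snd s)"
    using inseparable_not_both_sides[OF G _ lXY(2)] lXY(3) by blast
  then show "\<not> sep_le s (prod.swap s)"
    using lXY(4) unfolding sep_le_iff distinguishes_sets_def fst_swap by blast
next
  fix s t assume "s \<in> nested_seps G k" "t \<in> nested_seps G k"
  then show "nested s t" by (rule nested_seps_nested[OF G])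
qed

lemma sep_order_nested_seps: "s \<in> nested_seps G (Suc k) \<Longrightarrow> sep_order s \<le> k"
  by (erule nested_sepsD) simp

theorem theorem2:
  fixes G :: "'a pair_pre_digraph"
  assumes "pair_graph G"
  shows "\<exists>(T :: nat \<Rightarrow> nat pair_pre_digraph) (V :: nat \<Rightarrow> nat \<Rightarrow> 'a set). \<forall>k.
    tree_decomposition G (T k) (V k) \<and>
    adhesion (T k) (V k) \<le> k \<and>
    (\<forall>X Y. robust_block G k X \<and> robust_block G k Y \<and> X \<noteq> Y \<longrightarrow> distinguishes (T k) (V k) X Y) \<and>
    td_le (T k) (V k) (T (Suc k)) (V (Suc k)) \<and>
    Aut_invariant G (T k) (V k)"
proof -
  let ?N = "\<lambda>k. nested_seps G (Suc k)"
  have "\<forall>k. \<exists>(T :: nat pair_pre_digraph) ori. orientation_tree G (?N k) T ori"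
    using nested_separations.orientation_tree_exists[OF nested_separations_nested_seps[OF assms]]
    by blast
  then obtain T :: "nat \<Rightarrow> nat pair_pre_digraph" and ori
    where T: "\<And>k. orientation_tree G (?N k) (T k) (ori k)"
    by metis
  have dist: "distinguishes (T k) (part G \<circ> ori k) X Y"
    if XY: "robust_block G k X" "robust_block G k Y" "X \<noteq> Y" for k X Y
  proof -
    obtain s where s: "s \<in> ?N k" "distinguishes_sets s X Y"
      using nested_seps_distinguish[OF assms XY] .
    have "inseparable G k X" "inseparable G k Y"
      using XY by (simp_all add: robust_block_def block_def)
    then show ?thesis
      using orientation_tree.distinguishes[OF T _ _ s] sep_order_nested_seps by blast
  qed
  show ?thesis
  proof (intro exI[of _ T] exI[of _ "\<lambda>k. part G \<circ> ori k"] allI conjI impI)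
    fix k
    show "tree_decomposition G (T k) (part G \<circ> ori k)"
      by (rule orientation_tree.tree_decomposition[OF T])
    show "adhesion (T k) (part G \<circ> ori k) \<le> k"
      by (rule orientation_tree.adhesion_le[OF T sep_order_nested_seps])
    show "td_le (T k) (part G \<circ> ori k) (T (Suc k)) (part G \<circ> ori (Suc k))"
      by (rule td_le_if_subset[OF T T nested_seps_mono]) simp
    show "Aut_invariant G (T k) (part G \<circ> ori k)"
      by (rule orientation_tree.Aut_invariant[OF T nested_seps_act[OF assms]])
    fix X Y
    assume "robust_block G k X \<and> robust_block G k Y \<and> X \<noteq> Y"
    then show "distinguishes (T k) (part G \<circ> ori k) X Y" using dist by blast
  qed
qed

end
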